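(* Let $1\le n\le m$ and let $G$ be the clique sum of two odd cycles $C_1=(x_1,\ldots,x_{2n+1})$ and $C_2=(x_1,y_2,\ldots,y_{2m+1})$ joined at the vertex $x_1$. Let $I=I(G)$ be the edge ideal. Then for any $t\in\mathbb{N}$, $$\alpha(I^{(t)})=2t-\left\lfloor\frac{t}{n+1}\right\rfloor .$$ In particular, the Waldschmidt constant of $I$ is $$\widehat{\alpha}(I)=\frac{2n+1}{n+1}.$$
   Context: Let $k$ be a field. For a finite simple graph $G$, the edge ideal $I(G)$ is the ideal generated by all products $uv$ with $\{u,v\}$ an edge of $G$, in the polynomial ring over $k$ whose variables are the vertices of $G$. The $t$-th symbolic power of an ideal $I$ of a ring $R$ is $I^{(t)}=\bigcap_{p\in\operatorname{Ass} I}(I^tR_p\cap R)$; for an edge ideal it equals $\bigcap_V P_V^t$, where $V$ runs over the minimal vertex covers of $G$ and $P_V$ is the ideal generated by the variables in $V$. The clique sum of the cycles $C_1=(x_1,x_2,\ldots,x_{2n+1})$ and $C_2=(x_1,y_2,\ldots,y_{2m+1})$ joined at $x_1$ is the union of the two cycles (consecutive vertices adjacent, last vertex adjacent to $x_1$), which share exactly the vertex $x_1$ and no edge. For a nonzero homogeneous ideal $J$, $\alpha(J)$ is the least degree of a generator (equivalently, of a nonzero element) of $J$. The Waldschmidt constant is $\widehat{\alpha}(I)=\lim_{s\to\infty}\alpha(I^{(s)})/s$. *)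

theory Defs
  imports Complex_Main "HOL-Library.Poly_Mapping" "HOL-Algebra.Ideal_Product"
begin

section \<open>Polynomial rings\<close>

text \<open>
  A monomial is a finitely supported exponent function, and a polynomial is a finitely supported
  coefficient function on monomials. The type of polynomials has every element of the type
  \<open>'v\<close> as a variable; \<open>poly_ring V\<close> is the polynomial ring in the variables \<open>V\<close> only.
\<close>

definition poly_ring :: "'v set \<Rightarrow> (('v \<Rightarrow>\<^sub>0 nat) \<Rightarrow>\<^sub>0 'k::field) ring" where
  "poly_ring V =
     \<lparr>carrier = {f. \<forall>m\<in>Poly_Mapping.keys f. Poly_Mapping.keys m \<subseteq> V},
      mult = (*), one = 1, zero = 0, add = (+)\<rparr>"

definition var :: "'v \<Rightarrow> ('v \<Rightarrow>\<^sub>0 nat) \<Rightarrow>\<^sub>0 'k::field" where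
  "var v = Poly_Mapping.single (Poly_Mapping.single v 1) 1"

definition monom_degree :: "('v \<Rightarrow>\<^sub>0 nat) \<Rightarrow> nat" where
  "monom_degree m = (\<Sum>v\<in>Poly_Mapping.keys m. Poly_Mapping.lookup m v)"

text \<open>Only meaningful for nonzero polynomials.\<close>

definition total_degree :: "(('v \<Rightarrow>\<^sub>0 nat) \<Rightarrow>\<^sub>0 'k::field) \<Rightarrow> nat" where
  "total_degree f = Max (monom_degree ` Poly_Mapping.keys f)"


section \<open>Localization at a prime\<close>

text \<open>
  \<open>R\<^sub>p\<close> consists of the classes \<open>a/s\<close> of pairs with \<open>s \<notin> p\<close>, where \<open>a/s = b/t\<close>
  iff \<open>u (a t - b s) = 0\<close> for some \<open>u \<notin> p\<close>.
\<close>

definition loc_rel :: "('a, 'm) ring_scheme \<Rightarrow> 'a set \<Rightarrow> (('a \<times> 'a) \<times> ('a \<times> 'a)) set" where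
  "loc_rel R p =
     {((a, s), (b, t)) | a s b t.
        a \<in> carrier R \<and> s \<in> carrier R - p \<and> b \<in> carrier R \<and> t \<in> carrier R - p \<and>
        (\<exists>u\<in>carrier R - p. u \<otimes>\<^bsub>R\<^esub> (a \<otimes>\<^bsub>R\<^esub> t \<ominus>\<^bsub>R\<^esub> b \<otimes>\<^bsub>R\<^esub> s) = \<zero>\<^bsub>R\<^esub>)}"

definition loc_frac :: "('a, 'm) ring_scheme \<Rightarrow> 'a set \<Rightarrow> 'a \<Rightarrow> 'a \<Rightarrow> ('a \<times> 'a) set" where
  "loc_frac R p a s = loc_rel R p `` {(a, s)}"

text \<open>
  As in the library's quotient rings, the operations are given by uniting over all
  representatives; the classes being united all coincide.
\<close>

definition localization :: "('a, 'm) ring_scheme \<Rightarrow> 'a set \<Rightarrow> ('a \<times> 'a) set ring" where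
  "localization R p =
     \<lparr>carrier = (carrier R \<times> (carrier R - p)) // loc_rel R p,
      mult = (\<lambda>A B. \<Union>(a, s)\<in>A. \<Union>(b, t)\<in>B. loc_frac R p (a \<otimes>\<^bsub>R\<^esub> b) (s \<otimes>\<^bsub>R\<^esub> t)),
      one = loc_frac R p \<one>\<^bsub>R\<^esub> \<one>\<^bsub>R\<^esub>,
      zero = loc_frac R p \<zero>\<^bsub>R\<^esub> \<one>\<^bsub>R\<^esub>,
      add = (\<lambda>A B. \<Union>(a, s)\<in>A. \<Union>(b, t)\<in>B.
               loc_frac R p (a \<otimes>\<^bsub>R\<^esub> t \<oplus>\<^bsub>R\<^esub> b \<otimes>\<^bsub>R\<^esub> s) (s \<otimes>\<^bsub>R\<^esub> t))\<rparr>"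

text \<open>
  \<open>J R\<^sub>p \<inter> R\<close>: the preimage, under the canonical map \<open>f \<mapsto> f/1\<close>, of the ideal of \<open>R\<^sub>p\<close>
  generated by the image of \<open>J\<close>.
\<close>

definition loc_contraction :: "('a, 'm) ring_scheme \<Rightarrow> 'a set \<Rightarrow> 'a set \<Rightarrow> 'a set" where
  "loc_contraction R p J =
     {f \<in> carrier R.
        loc_frac R p f \<one>\<^bsub>R\<^esub> \<in> Idl\<^bsub>localization R p\<^esub> ((\<lambda>g. loc_frac R p g \<one>\<^bsub>R\<^esub>) ` J)}"


section \<open>Symbolic powers\<close>

text \<open>\<open>Ass I\<close> means, as usual for ideals, the set of associated primes of the module \<open>R/I\<close>.\<close>

definition assoc_primes :: "('a, 'm) ring_scheme \<Rightarrow> 'a set \<Rightarrow> 'a set set" where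
  "assoc_primes R I =
     {p. primeideal p R \<and> (\<exists>f\<in>carrier R. p = {r \<in> carrier R. r \<otimes>\<^bsub>R\<^esub> f \<in> I})}"

text \<open>
  The ordinary power is taken in the library's monoid of ideals. Intersecting with the carrier
  only matters when there are no associated primes.
\<close>

definition symbolic_power :: "('a, 'm) ring_scheme \<Rightarrow> 'a set \<Rightarrow> nat \<Rightarrow> 'a set" where
  "symbolic_power R I t =
     carrier R \<inter> (\<Inter>p\<in>assoc_primes R I. loc_contraction R p (I [^]\<^bsub>ideals_set R\<^esub> t))"


section \<open>Initial degree and Waldschmidt constant\<close>

definition alpha :: "(('v \<Rightarrow>\<^sub>0 nat) \<Rightarrow>\<^sub>0 'k::field) set \<Rightarrow> nat" where
  "alpha J = (LEAST d. \<exists>f\<in>J. f \<noteq> 0 \<and> total_degree f = d)"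

definition waldschmidt_constant ::
    "(('v \<Rightarrow>\<^sub>0 nat) \<Rightarrow>\<^sub>0 'k::field) ring \<Rightarrow> (('v \<Rightarrow>\<^sub>0 nat) \<Rightarrow>\<^sub>0 'k) set \<Rightarrow> real" where
  "waldschmidt_constant R I = lim (\<lambda>s. real (alpha (symbolic_power R I s)) / real s)"


section \<open>Graphs and edge ideals\<close>

text \<open>
  A graph is given by its vertex set and its set of edges, an edge being the set of its two
  endpoints.
\<close>

type_synonym 'v graph = "'v set \<times> 'v set set"

definition edge_ideal :: "'v graph \<Rightarrow> (('v \<Rightarrow>\<^sub>0 nat) \<Rightarrow>\<^sub>0 'k::field) set" where
  "edge_ideal G = Idl\<^bsub>poly_ring (fst G)\<^esub> {var u * var v | u v. {u, v} \<in> snd G}"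

text \<open>The cycle through a list of (at least three, distinct) vertices.\<close>

definition cycle_graph :: "'v list \<Rightarrow> 'v graph" where
  "cycle_graph xs = (set xs, {{xs ! i, xs ! (Suc i mod length xs)} | i. i < length xs})"

definition graph_union :: "'v graph \<Rightarrow> 'v graph \<Rightarrow> 'v graph" where
  "graph_union G H = (fst G \<union> fst H, snd G \<union> snd H)"

end

theory Submission
  imports Defs "HOL-Algebra.Multiplicative_Group"
begin

text \<open>
  Localizing at the prime of a minimal vertex cover \<open>V\<close> turns the edge ideal into the ideal of the
  variables in \<open>V\<close>, so a polynomial lies in the \<open>t\<close>-th symbolic power iff each of its monomials has
  degree at least \<open>t\<close> in the variables of every minimal cover. Every cover meets the shorter
  odd cycle in at least \<open>n + 1\<close> vertices; hence for \<open>t = q (n + 1) + r\<close> the product of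
  \<open>(x\<^sub>1 \<cdots> x\<^bsub>2n+1\<^esub>)^q\<close> and \<open>(x\<^sub>1 x\<^sub>2)^r\<close>, of degree \<open>2 t - q\<close>, is in the symbolic power. Conversely, since
  \<open>n \<le> m\<close>, the graph folds onto the cycle of length \<open>2n + 1\<close>, and averaging over the pullbacks of
  the rotations of a cover with \<open>n + 1\<close> elements bounds every degree from below by
  \<open>(2n + 1) t / (n + 1)\<close>.
\<close>

section \<open>Contraction from a localization\<close>

text \<open>The two inclusions for symbolic powers meet Ass I from opposite sides: every minimal
  cover \<open>V\<close> yields an associated prime \<open>P_V\<close>, and every associated prime
  \<open>p\<close> yields a minimal cover, the vertices whose variable lies in \<open>p\<close>. The
  delicate point is cancellation: from \<open>s * f\<close> in the \<open>t\<close>-th power of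
  \<open>P_V\<close> with \<open>s\<close> outside \<open>P_V\<close> one must recover
  \<open>f\<close>, although \<open>s\<close> need not be a monomial and terms of the product may
  cancel. The constant (2n+1)/(n+1) is the value of a linear program: minimize the total weight of
  the vertices so that every cover has weight at least 1. Weight 1/(n+1) on each vertex of the
  shorter cycle is feasible, and weight 1/(n+1) on each of 2n+1 suitable covers is a dual solution
  of the same value. A homomorphism between odd cycles cannot go to a longer one, so these covers
  have to come from the shorter cycle. For \<open>t\<close> not divisible by n+1 the linear bound is
  fractional, and rounding it up yields exactly the floor in the formula.\<close>

lemma UN_pairs_const:
  assumes "(a, s) \<in> A" "(b, t) \<in> B"
    and "\<And>a s b t. \<lbrakk>(a, s) \<in> A; (b, t) \<in> B\<rbrakk> \<Longrightarrow> F a s b t = C"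
  shows "(\<Union>(a, s)\<in>A. \<Union>(b, t)\<in>B. F a s b t) = C"
proof -
  have "(\<Union>(a, s)\<in>A. \<Union>(b, t)\<in>B. F a s b t) = (\<Union>x\<in>A. \<Union>y\<in>B. C)"
    using assms(3) by (intro SUP_cong) auto
  also have "\<dots> = C"
    using assms(1,2) by auto
  finally show ?thesis .
qed

context primeideal
begin

lemma one_notin_prime: "\<one> \<notin> I"
  using I_notcarr one_imp_carrier by blast

lemma mult_closed_compl:
  "s \<in> carrier R - I \<Longrightarrow> t \<in> carrier R - I \<Longrightarrow> s \<otimes> t \<in> carrier R - I"
  using I_prime by blast

lemma mult_notin_prime:
  "\<lbrakk>s \<in> carrier R; s \<notin> I; t \<in> carrier R; t \<notin> I\<rbrakk> \<Longrightarrow> s \<otimes> t \<notin> I"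
  using I_prime by blast

lemma one_compl: "\<one> \<in> carrier R - I"
  using one_notin_prime by blast

text \<open>Without the subtraction in \<open>loc_rel\<close>, the calculations with fractions
  reduce to commutative rearrangement.\<close>

lemma loc_rel_iff:
  assumes "a \<in> carrier R" "s \<in> carrier R - I" "b \<in> carrier R" "t \<in> carrier R - I"
  shows "((a, s), (b, t)) \<in> loc_rel R I \<longleftrightarrow>
           (\<exists>u\<in>carrier R - I. u \<otimes> (a \<otimes> t) = u \<otimes> (b \<otimes> s))"
proof -
  have "u \<otimes> (a \<otimes> t \<ominus> b \<otimes> s) = \<zero> \<longleftrightarrow> u \<otimes> (a \<otimes> t) = u \<otimes> (b \<otimes> s)"
    if "u \<in> carrier R - I" for u
  proof -
    have "u \<otimes> (a \<otimes> t \<ominus> b \<otimes> s) = u \<otimes> (a \<otimes> t) \<ominus> u \<otimes> (b \<otimes> s)"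
      using assms that by (simp add: a_minus_def r_distr r_minus)
    then show ?thesis
      using assms that r_right_minus_eq by auto
  qed
  with assms show ?thesis
    by (auto simp: loc_rel_def)
qed

lemma equiv_loc_rel: "equiv (carrier R \<times> (carrier R - I)) (loc_rel R I)"
proof (rule equivI)
  show "loc_rel R I \<subseteq> (carrier R \<times> (carrier R - I)) \<times> (carrier R \<times> (carrier R - I))"
    by (auto simp: loc_rel_def)
  show "refl_on (carrier R \<times> (carrier R - I)) (loc_rel R I)"
    using loc_rel_iff one_compl by (auto intro!: refl_onI)
  show "sym (loc_rel R I)"
  proof (rule symI)
    fix x y assume *: "(x, y) \<in> loc_rel R I"
    obtain a s b t where xy: "x = (a, s)" "y = (b, t)"
      by fastforce
    from * xy have "a \<in> carrier R" "s \<in> carrier R - I" "b \<in> carrier R" "t \<in> carrier R - I"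
      by (auto simp: loc_rel_def)
    with * show "(y, x) \<in> loc_rel R I"
      unfolding xy by (simp add: loc_rel_iff) metis
  qed
  show "trans (loc_rel R I)"
  proof (rule transI)
    fix x y z assume *: "(x, y) \<in> loc_rel R I" "(y, z) \<in> loc_rel R I"
    obtain a s b t c r where xyz: "x = (a, s)" "y = (b, t)" "z = (c, r)"
      by (metis surj_pair)
    from * xyz have carr: "a \<in> carrier R" "s \<in> carrier R - I" "b \<in> carrier R"
        "t \<in> carrier R - I" "c \<in> carrier R" "r \<in> carrier R - I"
      by (auto simp: loc_rel_def)
    from * carr obtain u v where u: "u \<in> carrier R - I" "u \<otimes> (a \<otimes> t) = u \<otimes> (b \<otimes> s)"
      and v: "v \<in> carrier R - I" "v \<otimes> (b \<otimes> r) = v \<otimes> (c \<otimes> t)"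
      unfolding xyz by (auto simp only: loc_rel_iff)
    \<comment> \<open>The multiplier contains the middle denominator \<open>t\<close>, because
      \<open>b\<close> is eliminated only after the first equation is scaled by
      \<open>v \<otimes> r\<close> and the second by \<open>u \<otimes> s\<close>.\<close>
    have "(u \<otimes> v \<otimes> t) \<otimes> (a \<otimes> r) = (v \<otimes> r) \<otimes> (u \<otimes> (a \<otimes> t))"
      using carr u(1) v(1) by (simp add: m_ac)
    also have "\<dots> = (u \<otimes> s) \<otimes> (v \<otimes> (b \<otimes> r))"
      unfolding u(2) using carr u(1) v(1) by (simp add: m_ac)
    also have "\<dots> = (u \<otimes> v \<otimes> t) \<otimes> (c \<otimes> s)"
      unfolding v(2) using carr u(1) v(1) by (simp add: m_ac)
    finally have "(u \<otimes> v \<otimes> t) \<otimes> (a \<otimes> r) = (u \<otimes> v \<otimes> t) \<otimes> (c \<otimes> s)" .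
    moreover have "u \<otimes> v \<otimes> t \<in> carrier R - I"
      using carr u(1) v(1) mult_closed_compl by blast
    ultimately show "(x, z) \<in> loc_rel R I"
      unfolding xyz using carr loc_rel_iff by blast
  qed
qed

lemma loc_frac_eq_iff:
  assumes "a \<in> carrier R" "s \<in> carrier R - I" "b \<in> carrier R" "t \<in> carrier R - I"
  shows "loc_frac R I a s = loc_frac R I b t \<longleftrightarrow>
           (\<exists>u\<in>carrier R - I. u \<otimes> (a \<otimes> t) = u \<otimes> (b \<otimes> s))"
  using eq_equiv_class_iff[OF equiv_loc_rel, of "(a, s)" "(b, t)"] assms
  by (simp add: loc_frac_def loc_rel_iff)

lemma loc_frac_eqI:
  assumes "a \<in> carrier R" "s \<in> carrier R - I" "b \<in> carrier R" "t \<in> carrier R - I"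
    and "a \<otimes> t = b \<otimes> s"
  shows "loc_frac R I a s = loc_frac R I b t"
  using assms loc_frac_eq_iff one_compl by auto

lemma mem_loc_frac_iff:
  assumes "a \<in> carrier R" "s \<in> carrier R - I"
  shows "(b, t) \<in> loc_frac R I a s \<longleftrightarrow>
           b \<in> carrier R \<and> t \<in> carrier R - I \<and> loc_frac R I b t = loc_frac R I a s"
proof -
  have "(b, t) \<in> loc_frac R I a s \<longleftrightarrow>
          b \<in> carrier R \<and> t \<in> carrier R - I \<and> ((a, s), (b, t)) \<in> loc_rel R I"
    by (auto simp: loc_frac_def loc_rel_def)
  also have "\<dots> \<longleftrightarrow> b \<in> carrier R \<and> t \<in> carrier R - I \<and> loc_frac R I b t = loc_frac R I a s"
    using assms loc_frac_eq_iff[of b t a s] loc_rel_iff[of a s b t] by metis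
  finally show ?thesis .
qed

lemma loc_frac_in_carrier:
  "a \<in> carrier R \<Longrightarrow> s \<in> carrier R - I \<Longrightarrow> loc_frac R I a s \<in> carrier (localization R I)"
  by (auto simp: localization_def loc_frac_def intro: quotientI)

lemma loc_carrierE:
  assumes "x \<in> carrier (localization R I)"
  obtains a s where "a \<in> carrier R" "s \<in> carrier R - I" "x = loc_frac R I a s"
  using assms by (auto simp: localization_def loc_frac_def elim!: quotientE)

lemma loc_frac_mult:
  assumes "a \<in> carrier R" "s \<in> carrier R - I" "b \<in> carrier R" "t \<in> carrier R - I"
  shows "loc_frac R I a s \<otimes>\<^bsub>localization R I\<^esub> loc_frac R I b t = loc_frac R I (a \<otimes> b) (s \<otimes> t)"
proof -
  have *: "loc_frac R I (a' \<otimes> b') (s' \<otimes> t') = loc_frac R I (a \<otimes> b) (s \<otimes> t)"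
    if "(a', s') \<in> loc_frac R I a s" "(b', t') \<in> loc_frac R I b t" for a' s' b' t'
  proof -
    have carr: "a' \<in> carrier R" "s' \<in> carrier R - I" "b' \<in> carrier R" "t' \<in> carrier R - I"
      using that assms mem_loc_frac_iff by blast+
    have "loc_frac R I a' s' = loc_frac R I a s" "loc_frac R I b' t' = loc_frac R I b t"
      using that assms mem_loc_frac_iff by blast+
    then obtain u v where u: "u \<in> carrier R - I" "u \<otimes> (a' \<otimes> s) = u \<otimes> (a \<otimes> s')"
      and v: "v \<in> carrier R - I" "v \<otimes> (b' \<otimes> t) = v \<otimes> (b \<otimes> t')"
      using loc_frac_eq_iff[OF carr(1,2) assms(1,2)] loc_frac_eq_iff[OF carr(3,4) assms(3,4)]
      by blast
    have "(u \<otimes> v) \<otimes> ((a' \<otimes> b') \<otimes> (s \<otimes> t)) = (u \<otimes> (a' \<otimes> s)) \<otimes> (v \<otimes> (b' \<otimes> t))"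
      using carr assms u(1) v(1) by (simp add: m_ac)
    also have "\<dots> = (u \<otimes> v) \<otimes> ((a \<otimes> b) \<otimes> (s' \<otimes> t'))"
      unfolding u(2) v(2) using carr assms u(1) v(1) by (simp add: m_ac)
    finally show ?thesis
      using carr assms u(1) v(1) mult_closed_compl
      by (subst loc_frac_eq_iff) (auto intro!: bexI[of _ "u \<otimes> v"])
  qed
  \<comment> \<open>The union over representatives collapses because all its terms agree; these
    memberships keep it from being empty.\<close>
  have mem: "(a, s) \<in> loc_frac R I a s" "(b, t) \<in> loc_frac R I b t"
    using assms mem_loc_frac_iff by blast+
  show ?thesis
    unfolding localization_def monoid.simps ring.simps by (rule UN_pairs_const[OF mem *])
qed

lemma loc_frac_add:
  assumes "a \<in> carrier R" "s \<in> carrier R - I" "b \<in> carrier R" "t \<in> carrier R - I"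
  shows "loc_frac R I a s \<oplus>\<^bsub>localization R I\<^esub> loc_frac R I b t =
           loc_frac R I (a \<otimes> t \<oplus> b \<otimes> s) (s \<otimes> t)"
proof -
  have *: "loc_frac R I (a' \<otimes> t' \<oplus> b' \<otimes> s') (s' \<otimes> t') = loc_frac R I (a \<otimes> t \<oplus> b \<otimes> s) (s \<otimes> t)"
    if "(a', s') \<in> loc_frac R I a s" "(b', t') \<in> loc_frac R I b t" for a' s' b' t'
  proof -
    have carr: "a' \<in> carrier R" "s' \<in> carrier R - I" "b' \<in> carrier R" "t' \<in> carrier R - I"
      using that assms mem_loc_frac_iff by blast+
    have "loc_frac R I a' s' = loc_frac R I a s" "loc_frac R I b' t' = loc_frac R I b t"
      using that assms mem_loc_frac_iff by blast+
    then obtain u v where u: "u \<in> carrier R - I" "u \<otimes> (a' \<otimes> s) = u \<otimes> (a \<otimes> s')"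
      and v: "v \<in> carrier R - I" "v \<otimes> (b' \<otimes> t) = v \<otimes> (b \<otimes> t')"
      using loc_frac_eq_iff[OF carr(1,2) assms(1,2)] loc_frac_eq_iff[OF carr(3,4) assms(3,4)]
      by blast
    have "(u \<otimes> v) \<otimes> ((a' \<otimes> t' \<oplus> b' \<otimes> s') \<otimes> (s \<otimes> t)) =
        (u \<otimes> (a' \<otimes> s)) \<otimes> (v \<otimes> t \<otimes> t') \<oplus> (v \<otimes> (b' \<otimes> t)) \<otimes> (u \<otimes> s \<otimes> s')"
      using carr assms u(1) v(1) by (simp add: m_ac r_distr l_distr)
    also have "\<dots> = (u \<otimes> v) \<otimes> ((a \<otimes> t \<oplus> b \<otimes> s) \<otimes> (s' \<otimes> t'))"
      unfolding u(2) v(2) using carr assms u(1) v(1) by (simp add: m_ac r_distr l_distr)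
    finally show ?thesis
      using carr assms u(1) v(1) mult_closed_compl
      by (subst loc_frac_eq_iff) (auto intro!: bexI[of _ "u \<otimes> v"])
  qed
  have mem: "(a, s) \<in> loc_frac R I a s" "(b, t) \<in> loc_frac R I b t"
    using assms mem_loc_frac_iff by blast+
  show ?thesis
    unfolding localization_def monoid.simps ring.simps by (rule UN_pairs_const[OF mem *])
qed

lemma loc_one: "\<one>\<^bsub>localization R I\<^esub> = loc_frac R I \<one> \<one>"
  and loc_zero: "\<zero>\<^bsub>localization R I\<^esub> = loc_frac R I \<zero> \<one>"
  by (simp_all add: localization_def)

lemma cring_localization: "cring (localization R I)"
proof (rule cringI)
  let ?L = "localization R I"
  show "abelian_group ?L"
  proof (rule abelian_groupI)
    fix x y assume "x \<in> carrier ?L" "y \<in> carrier ?L"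
    then show "x \<oplus>\<^bsub>?L\<^esub> y \<in> carrier ?L"
      by (elim loc_carrierE) (simp add: loc_frac_add loc_frac_in_carrier mult_notin_prime)
  next
    show "\<zero>\<^bsub>?L\<^esub> \<in> carrier ?L"
      using loc_frac_in_carrier loc_zero one_notin_prime by simp
  next
    fix x y z assume "x \<in> carrier ?L" "y \<in> carrier ?L" "z \<in> carrier ?L"
    then show "x \<oplus>\<^bsub>?L\<^esub> y \<oplus>\<^bsub>?L\<^esub> z = x \<oplus>\<^bsub>?L\<^esub> (y \<oplus>\<^bsub>?L\<^esub> z)"
    proof (elim loc_carrierE, goal_cases)
      case (1 a s b t c r)
      then have "s \<in> carrier R" "t \<in> carrier R" "r \<in> carrier R"
        by auto
      with 1 show ?case
        by (simp add: loc_frac_add mult_notin_prime)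
          (simp add: m_ac r_distr l_distr a_ac)
    qed
  next
    fix x y assume "x \<in> carrier ?L" "y \<in> carrier ?L"
    then show "x \<oplus>\<^bsub>?L\<^esub> y = y \<oplus>\<^bsub>?L\<^esub> x"
    proof (elim loc_carrierE, goal_cases)
      case (1 a s b t)
      then have "s \<in> carrier R" "t \<in> carrier R"
        by auto
      with 1 show ?case
        by (simp add: loc_frac_add mult_notin_prime m_ac a_ac)
    qed
  next
    fix x assume "x \<in> carrier ?L"
    then show "\<zero>\<^bsub>?L\<^esub> \<oplus>\<^bsub>?L\<^esub> x = x"
    proof (elim loc_carrierE, goal_cases)
      case (1 a s)
      then have "s \<in> carrier R"
        by auto
      with 1 show ?case
        by (simp add: loc_frac_add loc_zero one_notin_prime)
    qed
  next
    fix x assume "x \<in> carrier ?L"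
    then show "\<exists>y\<in>carrier ?L. y \<oplus>\<^bsub>?L\<^esub> x = \<zero>\<^bsub>?L\<^esub>"
    proof (elim loc_carrierE, goal_cases)
      case (1 a s)
      then have s: "s \<in> carrier R"
        by auto
      have "loc_frac R I (\<ominus> a) s \<oplus>\<^bsub>?L\<^esub> x = loc_frac R I \<zero> (s \<otimes> s)"
        using 1 s by (simp add: loc_frac_add l_minus l_neg)
      also have "\<dots> = \<zero>\<^bsub>?L\<^esub>"
        unfolding loc_zero using 1 s mult_notin_prime one_notin_prime
        by (intro loc_frac_eqI) auto
      finally have "loc_frac R I (\<ominus> a) s \<oplus>\<^bsub>?L\<^esub> x = \<zero>\<^bsub>?L\<^esub>" .
      moreover have "loc_frac R I (\<ominus> a) s \<in> carrier ?L"
        using 1 by (simp add: loc_frac_in_carrier)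
      ultimately show ?case
        by (rule bexI)
    qed
  qed
  show "comm_monoid ?L"
  proof (rule comm_monoidI)
    fix x y assume "x \<in> carrier ?L" "y \<in> carrier ?L"
    then show "x \<otimes>\<^bsub>?L\<^esub> y \<in> carrier ?L"
      by (elim loc_carrierE) (simp add: loc_frac_mult loc_frac_in_carrier mult_notin_prime)
  next
    show "\<one>\<^bsub>?L\<^esub> \<in> carrier ?L"
      using loc_frac_in_carrier loc_one one_notin_prime by simp
  next
    fix x y z assume "x \<in> carrier ?L" "y \<in> carrier ?L" "z \<in> carrier ?L"
    then show "x \<otimes>\<^bsub>?L\<^esub> y \<otimes>\<^bsub>?L\<^esub> z = x \<otimes>\<^bsub>?L\<^esub> (y \<otimes>\<^bsub>?L\<^esub> z)"
    proof (elim loc_carrierE, goal_cases)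
      case (1 a s b t c r)
      then have "s \<in> carrier R" "t \<in> carrier R" "r \<in> carrier R"
        by auto
      with 1 show ?case
        by (simp add: loc_frac_mult mult_notin_prime m_assoc)
    qed
  next
    fix x y assume "x \<in> carrier ?L" "y \<in> carrier ?L"
    then show "x \<otimes>\<^bsub>?L\<^esub> y = y \<otimes>\<^bsub>?L\<^esub> x"
    proof (elim loc_carrierE, goal_cases)
      case (1 a s b t)
      then have "s \<in> carrier R" "t \<in> carrier R"
        by auto
      with 1 show ?case
        by (simp add: loc_frac_mult m_comm)
    qed
  next
    fix x assume "x \<in> carrier ?L"
    then show "\<one>\<^bsub>?L\<^esub> \<otimes>\<^bsub>?L\<^esub> x = x"
    proof (elim loc_carrierE, goal_cases)
      case (1 a s)
      then have "s \<in> carrier R"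
        by auto
      with 1 show ?case
        by (simp add: loc_frac_mult loc_one one_notin_prime)
    qed
  qed
  fix x y z assume "x \<in> carrier ?L" "y \<in> carrier ?L" "z \<in> carrier ?L"
  then show "(x \<oplus>\<^bsub>?L\<^esub> y) \<otimes>\<^bsub>?L\<^esub> z = x \<otimes>\<^bsub>?L\<^esub> z \<oplus>\<^bsub>?L\<^esub> y \<otimes>\<^bsub>?L\<^esub> z"
  proof (elim loc_carrierE, goal_cases)
    case (1 a s b t c r)
    then have carr: "s \<in> carrier R" "t \<in> carrier R" "r \<in> carrier R"
      by auto
    \<comment> \<open>The right-hand fraction is the left one expanded by \<open>r\<close>:
      multiplying out first brings the denominator \<open>r\<close> in twice.\<close>
    have "loc_frac R I ((a \<otimes> t \<oplus> b \<otimes> s) \<otimes> c) (s \<otimes> t \<otimes> r) =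
        loc_frac R I (a \<otimes> c \<otimes> (t \<otimes> r) \<oplus> b \<otimes> c \<otimes> (s \<otimes> r)) (s \<otimes> r \<otimes> (t \<otimes> r))"
      using 1 carr by (intro loc_frac_eqI) (simp_all add: mult_notin_prime m_ac r_distr l_distr)
    with 1 show ?case
      by (simp add: loc_frac_mult loc_frac_add mult_notin_prime carr)
  qed
qed

text \<open>Any two fractions have a common denominator, so sums of such fractions again have this
  form. The lemma gives the upper bound for the extension of \<open>J\<close> in
  \<open>loc_contraction_eq\<close>.\<close>

lemma ideal_localization:
  assumes "ideal J R"
  shows "ideal {loc_frac R I j s | j s. j \<in> J \<and> s \<in> carrier R - I} (localization R I)"
    (is "ideal ?K ?L")
proof -
  interpret J: ideal J R by fact
  interpret L: cring ?L by (rule cring_localization)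
  note Jcarr = J.Icarr
  have sub: "?K \<subseteq> carrier ?L"
    using J.Icarr loc_frac_in_carrier by blast
  have l: "x \<otimes>\<^bsub>?L\<^esub> k \<in> ?K" if "k \<in> ?K" "x \<in> carrier ?L" for k x
  proof -
    from that obtain j s a t where *: "k = loc_frac R I j s" "j \<in> J" "s \<in> carrier R - I"
      "x = loc_frac R I a t" "a \<in> carrier R" "t \<in> carrier R - I"
      by (auto elim: loc_carrierE)
    then have "x \<otimes>\<^bsub>?L\<^esub> k = loc_frac R I (a \<otimes> j) (t \<otimes> s)"
      using Jcarr by (simp add: loc_frac_mult)
    with * show ?thesis
      using J.I_l_closed mult_closed_compl by blast
  qed
  show ?thesis
  proof (rule idealI[OF L.ring_axioms _ l])
    show "subgroup ?K (add_monoid ?L)"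
    proof (rule L.add.subgroupI)
      show "?K \<subseteq> carrier ?L" by (rule sub)
      show "?K \<noteq> {}"
        using J.zero_closed one_compl by blast
      show "\<ominus>\<^bsub>?L\<^esub> k \<in> ?K" if "k \<in> ?K" for k
      proof -
        have "(\<ominus>\<^bsub>?L\<^esub> \<one>\<^bsub>?L\<^esub>) \<otimes>\<^bsub>?L\<^esub> k \<in> ?K"
          using that by (intro l) auto
        then show ?thesis
          using that sub by (simp add: L.l_minus subsetD)
      qed
      show "x \<oplus>\<^bsub>?L\<^esub> y \<in> ?K" if "x \<in> ?K" "y \<in> ?K" for x y
      proof -
        from that obtain i s j t where *: "x = loc_frac R I i s" "i \<in> J" "s \<in> carrier R - I"
          "y = loc_frac R I j t" "j \<in> J" "t \<in> carrier R - I"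
          by blast
        then have "x \<oplus>\<^bsub>?L\<^esub> y = loc_frac R I (i \<otimes> t \<oplus> j \<otimes> s) (s \<otimes> t)"
          using Jcarr by (simp add: loc_frac_add)
        moreover have "i \<otimes> t \<oplus> j \<otimes> s \<in> J"
          using * by (intro J.a_closed J.I_r_closed) auto
        ultimately show ?thesis
          using * mult_closed_compl by blast
      qed
    qed
    show "k \<otimes>\<^bsub>?L\<^esub> x \<in> ?K" if "k \<in> ?K" "x \<in> carrier ?L" for k x
      using l[OF that] that sub L.m_comm by (metis (no_types, lifting) subsetD)
  qed
qed

text \<open>Clearing denominators in \<open>f/1 = j/s\<close> gives a multiplier outside the prime;
  conversely \<open>f/1\<close> is \<open>1/s\<close> times the image of
  \<open>s \<otimes> f\<close>. From here on, localization enters only through this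
  criterion.\<close>

theorem loc_contraction_eq:
  assumes "ideal J R"
  shows "loc_contraction R I J = {f \<in> carrier R. \<exists>s\<in>carrier R - I. s \<otimes> f \<in> J}"
proof -
  interpret J: ideal J R by fact
  let ?L = "localization R I"
  interpret L: cring ?L by (rule cring_localization)
  let ?K = "{loc_frac R I j s | j s. j \<in> J \<and> s \<in> carrier R - I}"
  let ?S = "(\<lambda>g. loc_frac R I g \<one>) ` J"
  interpret E: ideal "Idl\<^bsub>?L\<^esub> ?S" ?L
    using J.Icarr loc_frac_in_carrier one_compl by (intro L.genideal_ideal) blast
  have "loc_frac R I f \<one> \<in> Idl\<^bsub>?L\<^esub> ?S \<longleftrightarrow> (\<exists>s\<in>carrier R - I. s \<otimes> f \<in> J)"
    if f: "f \<in> carrier R" for f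
  proof
    assume "loc_frac R I f \<one> \<in> Idl\<^bsub>?L\<^esub> ?S"
    moreover have "Idl\<^bsub>?L\<^esub> ?S \<subseteq> ?K"
      using one_compl by (intro L.genideal_minimal ideal_localization assms) blast
    ultimately obtain j s where j: "j \<in> J" "s \<in> carrier R - I"
      and eq: "loc_frac R I f \<one> = loc_frac R I j s"
      by blast
    from eq obtain u where u: "u \<in> carrier R - I" "u \<otimes> (f \<otimes> s) = u \<otimes> (j \<otimes> \<one>)"
      using f j J.Icarr one_compl loc_frac_eq_iff by metis
    have "(u \<otimes> s) \<otimes> f = u \<otimes> j"
      using u j f J.Icarr by (simp add: m_ac)
    also have "\<dots> \<in> J"
      using u j J.I_l_closed by blast
    finally show "\<exists>s\<in>carrier R - I. s \<otimes> f \<in> J"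
      using u j mult_closed_compl by blast
  next
    assume "\<exists>s\<in>carrier R - I. s \<otimes> f \<in> J"
    then obtain s where s: "s \<in> carrier R - I" "s \<otimes> f \<in> J"
      by blast
    then have "loc_frac R I \<one> s \<otimes>\<^bsub>?L\<^esub> loc_frac R I (s \<otimes> f) \<one> \<in> Idl\<^bsub>?L\<^esub> ?S"
      using J.Icarr one_compl loc_frac_in_carrier
      by (intro E.I_l_closed subsetD[OF L.genideal_self]) auto
    also have "loc_frac R I \<one> s \<otimes>\<^bsub>?L\<^esub> loc_frac R I (s \<otimes> f) \<one> = loc_frac R I (\<one> \<otimes> (s \<otimes> f)) (s \<otimes> \<one>)"
      using s f one_compl by (intro loc_frac_mult) auto
    also have "\<dots> = loc_frac R I f \<one>"
      using s f one_compl by (intro loc_frac_eqI) (auto simp: m_comm)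
    finally show "loc_frac R I f \<one> \<in> Idl\<^bsub>?L\<^esub> ?S" .
  qed
  then show ?thesis
    by (auto simp: loc_contraction_def)
qed

end

section \<open>Monomials and primes generated by variables\<close>

lemma carrier_poly_ring_iff:
  "f \<in> carrier (poly_ring A) \<longleftrightarrow> (\<forall>m\<in>Poly_Mapping.keys f. Poly_Mapping.keys m \<subseteq> A)"
  by (simp add: poly_ring_def)

lemma poly_ring_simps [simp]:
  "mult (poly_ring A) = (*)" "one (poly_ring A) = 1"
  "zero (poly_ring A) = 0" "add (poly_ring A) = (+)"
  by (simp_all add: poly_ring_def)

lemma keys_add_nat:
  fixes m m' :: "'v \<Rightarrow>\<^sub>0 nat"
  shows "Poly_Mapping.keys (m + m') = Poly_Mapping.keys m \<union> Poly_Mapping.keys m'"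
  by (auto simp: in_keys_iff lookup_add)

lemma add_in_poly_ring:
  "f \<in> carrier (poly_ring A) \<Longrightarrow> g \<in> carrier (poly_ring A) \<Longrightarrow> f + g \<in> carrier (poly_ring A)"
  using keys_add[of f g] by (auto simp: carrier_poly_ring_iff)

lemma mult_in_poly_ring:
  "f \<in> carrier (poly_ring A) \<Longrightarrow> g \<in> carrier (poly_ring A) \<Longrightarrow> f * g \<in> carrier (poly_ring A)"
  using keys_mult[of f g] by (fastforce simp: carrier_poly_ring_iff keys_add_nat)

lemma single_in_poly_ring:
  "Poly_Mapping.keys m \<subseteq> A \<Longrightarrow> Poly_Mapping.single m c \<in> carrier (poly_ring A)"
  by (simp add: carrier_poly_ring_iff)

lemma cring_poly_ring: "cring (poly_ring A :: (('v \<Rightarrow>\<^sub>0 nat) \<Rightarrow>\<^sub>0 'k::field) ring)"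
proof (rule cringI)
  show "abelian_group (poly_ring A :: (('v \<Rightarrow>\<^sub>0 nat) \<Rightarrow>\<^sub>0 'k) ring)"
  proof (rule abelian_groupI, goal_cases)
    case (6 x)
    then have "- x \<in> carrier (poly_ring A)"
      by (simp add: carrier_poly_ring_iff)
    then show ?case
      by (intro bexI[of _ "- x"]) auto
  qed (auto simp: add_in_poly_ring algebra_simps carrier_poly_ring_iff[of 0])
  show "comm_monoid (poly_ring A :: (('v \<Rightarrow>\<^sub>0 nat) \<Rightarrow>\<^sub>0 'k) ring)"
    by (rule comm_monoidI)
      (auto simp: mult_in_poly_ring algebra_simps carrier_poly_ring_iff[of 1])
qed (auto simp: algebra_simps)

lemma poly_mapping_sum_single:
  "f = (\<Sum>m\<in>Poly_Mapping.keys f. Poly_Mapping.single m (Poly_Mapping.lookup f m))"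
proof (rule poly_mapping_eqI)
  fix k
  have "(\<Sum>m\<in>Poly_Mapping.keys f. Poly_Mapping.lookup (Poly_Mapping.single m (Poly_Mapping.lookup f m)) k)
      = (\<Sum>m\<in>Poly_Mapping.keys f. if k = m then Poly_Mapping.lookup f k else 0)"
    by (intro sum.cong) (auto simp: lookup_single)
  also have "\<dots> = Poly_Mapping.lookup f k"
    by (simp add: in_keys_iff)
  finally show "Poly_Mapping.lookup f k = Poly_Mapping.lookup
      (\<Sum>m\<in>Poly_Mapping.keys f. Poly_Mapping.single m (Poly_Mapping.lookup f m)) k"
    by (simp add: lookup_sum)
qed

text \<open>If only one pair of terms contributes to the exponent \<open>a + b\<close>, its
  coefficient is a product of two nonzero coefficients and nothing can cancel it.\<close>

lemma add_in_keys_mult: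
  fixes f g :: "'a::comm_monoid_add \<Rightarrow>\<^sub>0 'k::{comm_ring_1, semiring_no_zero_divisors}"
  assumes "a \<in> Poly_Mapping.keys f" "b \<in> Poly_Mapping.keys g"
    and "\<And>a' b'. \<lbrakk>a' \<in> Poly_Mapping.keys f; b' \<in> Poly_Mapping.keys g; a' + b' = a + b\<rbrakk>
           \<Longrightarrow> a' = a \<and> b' = b"
  shows "a + b \<in> Poly_Mapping.keys (f * g)"
proof -
  let ?F = "Poly_Mapping.lookup f" and ?G = "Poly_Mapping.lookup g"
  have "f * g = (\<Sum>x\<in>Poly_Mapping.keys f. \<Sum>y\<in>Poly_Mapping.keys g.
      Poly_Mapping.single (x + y) (?F x * ?G y))"
    by (subst poly_mapping_sum_single[of f], subst poly_mapping_sum_single[of g])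
      (simp add: sum_product mult_single)
  then have "Poly_Mapping.lookup (f * g) (a + b) =
      (\<Sum>x\<in>Poly_Mapping.keys f. \<Sum>y\<in>Poly_Mapping.keys g. ?F x * ?G y when x + y = a + b)"
    by (simp add: lookup_sum lookup_single)
  also have "\<dots> = (\<Sum>x\<in>Poly_Mapping.keys f. \<Sum>y\<in>Poly_Mapping.keys g.
      if y = b then if x = a then ?F a * ?G b else 0 else 0)"
    using assms(3) by (intro sum.cong refl) (auto simp: when_def)
  also have "\<dots> = ?F a * ?G b"
    using assms(1,2) by (simp add: sum.delta)
  finally show ?thesis
    using assms(1,2) by (simp add: in_keys_iff)
qed

text \<open>
  This replaces leading monomials: the variables carry no order, so a monomial order is not
  directly available. The pair is found by maximizing the exponents of one variable after the other.
\<close>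

lemma ex_unique_sum:
  fixes A B :: "('v \<Rightarrow>\<^sub>0 nat) set"
  assumes "finite F" "finite A" "finite B" "A \<noteq> {}" "B \<noteq> {}"
    and "\<And>a a' v. \<lbrakk>a \<in> A; a' \<in> A; v \<notin> F\<rbrakk> \<Longrightarrow> Poly_Mapping.lookup a v = Poly_Mapping.lookup a' v"
    and "\<And>b b' v. \<lbrakk>b \<in> B; b' \<in> B; v \<notin> F\<rbrakk> \<Longrightarrow> Poly_Mapping.lookup b v = Poly_Mapping.lookup b' v"
  shows "\<exists>a\<in>A. \<exists>b\<in>B. \<forall>a'\<in>A. \<forall>b'\<in>B. a' + b' = a + b \<longrightarrow> a' = a \<and> b' = b"
  using assms
proof (induction F arbitrary: A B rule: finite_induct)
  case empty
  then obtain a b where "a \<in> A" "b \<in> B"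
    by blast
  moreover have "a' = a" if "a' \<in> A" for a'
    using that \<open>a \<in> A\<close> by (intro poly_mapping_eqI empty.prems(5)) auto
  moreover have "b' = b" if "b' \<in> B" for b'
    using that \<open>b \<in> B\<close> by (intro poly_mapping_eqI empty.prems(6)) auto
  ultimately show ?case
    by blast
next
  case (insert v F)
  let ?e = "\<lambda>m. Poly_Mapping.lookup m v"
  define A' where "A' = {a \<in> A. ?e a = Max (?e ` A)}"
  define B' where "B' = {b \<in> B. ?e b = Max (?e ` B)}"
  have "Max (?e ` A) \<in> ?e ` A" "Max (?e ` B) \<in> ?e ` B"
    using insert.prems(1-4) by (auto intro!: Max_in)
  then have A': "A' \<noteq> {}" "finite A'" and B': "B' \<noteq> {}" "finite B'"
    using insert.prems(1,2) unfolding A'_def B'_def image_iff by auto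
  have "\<exists>a\<in>A'. \<exists>b\<in>B'. \<forall>a'\<in>A'. \<forall>b'\<in>B'. a' + b' = a + b \<longrightarrow> a' = a \<and> b' = b"
  proof (rule insert.IH[OF A'(2) B'(2) A'(1) B'(1)])
    show "Poly_Mapping.lookup a w = Poly_Mapping.lookup a' w" if "a \<in> A'" "a' \<in> A'" "w \<notin> F" for a a' w
      using that insert.prems(5)[of a a' w] by (cases "w = v") (auto simp: A'_def)
    show "Poly_Mapping.lookup b w = Poly_Mapping.lookup b' w" if "b \<in> B'" "b' \<in> B'" "w \<notin> F" for b b' w
      using that insert.prems(6)[of b b' w] by (cases "w = v") (auto simp: B'_def)
  qed
  then obtain a b where ab: "a \<in> A'" "b \<in> B'"
    and uniq: "\<And>a' b'. \<lbrakk>a' \<in> A'; b' \<in> B'; a' + b' = a + b\<rbrakk> \<Longrightarrow> a' = a \<and> b' = b"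
    by blast
  \<comment> \<open>In \<open>a + b\<close> the exponent of \<open>v\<close> is the sum of the two
    maxima, so any other pair with the same sum must attain both maxima.\<close>
  have "a' \<in> A' \<and> b' \<in> B'" if "a' \<in> A" "b' \<in> B" "a' + b' = a + b" for a' b'
  proof -
    have "?e a' + ?e b' = ?e a + ?e b"
      using that by (metis lookup_add)
    moreover have "?e a' \<le> Max (?e ` A)" "?e b' \<le> Max (?e ` B)"
      using that insert.prems(1,2) by auto
    ultimately show ?thesis
      using that ab by (simp add: A'_def B'_def)
  qed
  with ab uniq show ?case
    unfolding A'_def B'_def by blast
qed

text \<open>Every monomial of a product is a multiple of a monomial of each factor, so a condition
  inherited by multiples is preserved. It serves for the edge ideal (\<open>U\<close>: the support
  contains an edge) and for the powers of \<open>P_V\<close> (\<open>U\<close>: degree at least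
  \<open>t\<close> in \<open>V\<close>).\<close>

lemma ideal_monomial_ideal:
  assumes "\<And>m m'. U m \<Longrightarrow> U (m + m')"
  shows "ideal {f \<in> carrier (poly_ring A). \<forall>m\<in>Poly_Mapping.keys f. U m}
           (poly_ring A :: (('v \<Rightarrow>\<^sub>0 nat) \<Rightarrow>\<^sub>0 'k::field) ring)" (is "ideal ?J ?R")
proof -
  interpret R: cring ?R by (rule cring_poly_ring)
  have l: "x * a \<in> ?J" if "a \<in> ?J" "x \<in> carrier ?R" for a x
  proof -
    have "U m" if m: "m \<in> Poly_Mapping.keys (x * a)" for m
    proof -
      obtain m1 m2 where "m = m2 + m1" "m2 \<in> Poly_Mapping.keys a"
        using keys_mult[of x a] m by (auto simp: add.commute)
      with \<open>a \<in> ?J\<close> assms show ?thesis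
        by auto
    qed
    with that show ?thesis
      by (auto simp: mult_in_poly_ring)
  qed
  show ?thesis
  proof (rule idealI[OF R.ring_axioms])
    show "subgroup ?J (add_monoid ?R)"
    proof (rule R.add.subgroupI)
      show "\<ominus>\<^bsub>?R\<^esub> a \<in> ?J" if "a \<in> ?J" for a
      proof -
        have "(\<ominus>\<^bsub>?R\<^esub> \<one>\<^bsub>?R\<^esub>) * a \<in> ?J"
          using R.one_closed R.a_inv_closed by (intro l that) auto
        moreover have "(\<ominus>\<^bsub>?R\<^esub> \<one>\<^bsub>?R\<^esub>) \<otimes>\<^bsub>?R\<^esub> a = \<ominus>\<^bsub>?R\<^esub> a"
          using that R.l_minus[OF R.one_closed, of a] R.l_one[of a] by simp
        ultimately show ?thesis
          by simp
      qed
    next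
      fix f g assume "f \<in> ?J" "g \<in> ?J"
      then show "f \<oplus>\<^bsub>?R\<^esub> g \<in> ?J"
        using keys_add[of f g] by (auto simp: add_in_poly_ring)
    next
      have "0 \<in> ?J"
        using R.zero_closed by simp
      then show "?J \<noteq> {}"
        by blast
    qed auto
  qed (use l in \<open>auto simp: mult.commute\<close>)
qed

text \<open>The factor \<open>h\<close> stands for the multiplier supplied by localization:
  \<open>h * f\<close> can be tested on the monomials of \<open>f\<close> even when \<open>f\<close>
  itself lies outside \<open>J\<close>.\<close>

lemma mult_in_idealI:
  fixes f h :: "('v \<Rightarrow>\<^sub>0 nat) \<Rightarrow>\<^sub>0 'k::field"
  assumes "ideal J (poly_ring A)"
    and "\<And>m. m \<in> Poly_Mapping.keys f \<Longrightarrow> h * Poly_Mapping.single m 1 \<in> J"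
  shows "h * f \<in> J"
proof -
  interpret J: ideal J "poly_ring A" by fact
  have *: "h * Poly_Mapping.single m (Poly_Mapping.lookup f m) \<in> J" if m: "m \<in> Poly_Mapping.keys f" for m
  proof -
    have "Poly_Mapping.single 0 (Poly_Mapping.lookup f m) * (h * Poly_Mapping.single m 1) \<in> J"
      using J.I_l_closed[OF assms(2)[OF m], of "Poly_Mapping.single 0 (Poly_Mapping.lookup f m)"]
      by (simp add: single_in_poly_ring)
    also have "Poly_Mapping.single 0 (Poly_Mapping.lookup f m) * (h * Poly_Mapping.single m 1) =
        h * (Poly_Mapping.single 0 (Poly_Mapping.lookup f m) * Poly_Mapping.single m 1)"
      by (simp only: ac_simps)
    finally show ?thesis
      by (simp add: mult_single)
  qed
  have "sum g K \<in> J" if "finite K" "\<And>m. m \<in> K \<Longrightarrow> g m \<in> J"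
    for g :: "_ \<Rightarrow> ('v \<Rightarrow>\<^sub>0 nat) \<Rightarrow>\<^sub>0 'k" and K :: "('v \<Rightarrow>\<^sub>0 nat) set"
    using that
  proof (induction K rule: finite_induct)
    case empty
    show ?case
      using additive_subgroup.zero_closed[OF J.is_additive_subgroup] by simp
  next
    case (insert x K)
    then show ?case
      using additive_subgroup.a_closed[OF J.is_additive_subgroup, of "g x" "sum g K"] by simp
  qed
  then show ?thesis
    using * by (subst poly_mapping_sum_single) (simp add: sum_distrib_left)
qed

lemma poly_in_idealI:
  assumes "ideal J (poly_ring A)"
    and "\<And>m. m \<in> Poly_Mapping.keys f \<Longrightarrow> Poly_Mapping.single m 1 \<in> J"
  shows "f \<in> J"
  using mult_in_idealI[of J A f 1] assms by simp

section \<open>Degree in a set of variables, and the powers of the prime these variables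
  generate\<close>

definition vdeg :: "'v set \<Rightarrow> ('v \<Rightarrow>\<^sub>0 nat) \<Rightarrow> nat" where
  "vdeg V m = (\<Sum>v\<in>V. Poly_Mapping.lookup m v)"

lemma vdeg_add: "vdeg V (m + m') = vdeg V m + vdeg V m'"
  by (simp add: vdeg_def lookup_add sum.distrib)

lemma vdeg_single:
  "finite V \<Longrightarrow> vdeg V (Poly_Mapping.single v k) = (if v \<in> V then k else 0)"
  by (simp add: vdeg_def lookup_single when_def)

lemma vdeg_eq_0_iff: "finite V \<Longrightarrow> vdeg V m = 0 \<longleftrightarrow> Poly_Mapping.keys m \<inter> V = {}"
  by (auto simp: vdeg_def in_keys_iff)

text \<open>Look at the parts of lowest degree in \<open>V\<close>: degree 0 in \<open>s\<close> and
  \<open>d\<close> in \<open>f\<close>. By \<open>ex_unique_sum\<close> their product has a term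
  that survives, and this term has degree \<open>d\<close>, so \<open>d\<close> is at least
  \<open>t\<close>.\<close>

lemma vdeg_le_of_mult:
  fixes f s :: "('v \<Rightarrow>\<^sub>0 nat) \<Rightarrow>\<^sub>0 'k::field"
  assumes "m0 \<in> Poly_Mapping.keys s" "vdeg V m0 = 0"
    and "\<And>m. m \<in> Poly_Mapping.keys (s * f) \<Longrightarrow> t \<le> vdeg V m"
    and "m1 \<in> Poly_Mapping.keys f"
  shows "t \<le> vdeg V m1"
proof -
  define A where "A = {m \<in> Poly_Mapping.keys s. vdeg V m = 0}"
  define d where "d = Min (vdeg V ` Poly_Mapping.keys f)"
  define B where "B = {m \<in> Poly_Mapping.keys f. vdeg V m = d}"
  have d_le: "d \<le> vdeg V m" if "m \<in> Poly_Mapping.keys f" for m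
    using that by (simp add: d_def)
  have "d \<in> vdeg V ` Poly_Mapping.keys f"
    unfolding d_def using assms(4) by (intro Min_in) auto
  then have ne: "A \<noteq> {}" "B \<noteq> {}"
    using assms(1,2) by (auto simp: A_def B_def)
  define F where "F = (\<Union>m\<in>A \<union> B. Poly_Mapping.keys m)"
  have "Poly_Mapping.lookup m v = 0" if "m \<in> A \<union> B" "v \<notin> F" for m v
    using that by (auto simp: F_def in_keys_iff)
  moreover have "finite A" "finite B" "finite F"
    by (auto simp: F_def A_def B_def)
  ultimately have "\<exists>a\<in>A. \<exists>b\<in>B. \<forall>a'\<in>A. \<forall>b'\<in>B. a' + b' = a + b \<longrightarrow> a' = a \<and> b' = b"
    using ne by (intro ex_unique_sum[of F]) simp_all
  then obtain a b where ab: "a \<in> A" "b \<in> B"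
    and uniq: "\<And>a' b'. \<lbrakk>a' \<in> A; b' \<in> B; a' + b' = a + b\<rbrakk> \<Longrightarrow> a' = a \<and> b' = b"
    by blast
  have "a + b \<in> Poly_Mapping.keys (s * f)"
  proof (rule add_in_keys_mult)
    show "a \<in> Poly_Mapping.keys s" "b \<in> Poly_Mapping.keys f"
      using ab by (auto simp: A_def B_def)
    \<comment> \<open>Uniqueness extends from \<open>A\<close> and \<open>B\<close> to all terms: if
      the degrees in \<open>V\<close> add up to \<open>d\<close> and that of \<open>b'\<close> is at
      least \<open>d\<close>, they are exactly 0 and \<open>d\<close>.\<close>
    fix a' b' assume *: "a' \<in> Poly_Mapping.keys s" "b' \<in> Poly_Mapping.keys f" "a' + b' = a + b"
    then have "vdeg V a' + vdeg V b' = d"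
      using ab vdeg_add[of V a' b'] vdeg_add[of V a b] by (simp add: A_def B_def)
    with * d_le[of b'] show "a' = a \<and> b' = b"
      by (intro uniq) (auto simp: A_def B_def)
  qed
  then have "t \<le> vdeg V (a + b)"
    by (rule assms(3))
  also have "\<dots> = d"
    using ab by (simp add: vdeg_add A_def B_def)
  also have "\<dots> \<le> vdeg V m1"
    using assms(4) by (rule d_le)
  finally show ?thesis .
qed

text \<open>For finite \<open>V\<close> contained in \<open>A\<close> this is the
  \<open>t\<close>-th power of the ideal generated by the variables in \<open>V\<close>, described
  by its monomials so that membership is a degree condition; \<open>t = 1\<close> gives the prime
  \<open>P_V\<close>.\<close>

definition vars_power :: "'v set \<Rightarrow> 'v set \<Rightarrow> nat \<Rightarrow> (('v \<Rightarrow>\<^sub>0 nat) \<Rightarrow>\<^sub>0 'k::field) set" where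
  "vars_power A V t = {f \<in> carrier (poly_ring A). \<forall>m\<in>Poly_Mapping.keys f. t \<le> vdeg V m}"

lemma ideal_vars_power: "ideal (vars_power A V t) (poly_ring A)"
  unfolding vars_power_def by (rule ideal_monomial_ideal) (simp add: vdeg_add)

lemma vars_power_mult:
  "f \<in> vars_power A V i \<Longrightarrow> g \<in> vars_power A V j \<Longrightarrow> f * g \<in> vars_power A V (i + j)"
  using keys_mult[of f g] by (fastforce simp: vars_power_def mult_in_poly_ring vdeg_add intro: add_mono)

text \<open>This is the sense in which the powers of \<open>P_V\<close> are
  \<open>P_V\<close>-primary; for \<open>t = 1\<close> it is the primality of
  \<open>P_V\<close>.\<close>

lemma vars_power_cancel:
  assumes "s \<in> carrier (poly_ring A) - vars_power A V 1" "f \<in> carrier (poly_ring A)"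
    and "s * f \<in> vars_power A V t"
  shows "f \<in> vars_power A V t"
proof -
  obtain m0 where "m0 \<in> Poly_Mapping.keys s" "vdeg V m0 = 0"
    using assms(1) by (auto simp: vars_power_def not_le)
  with vdeg_le_of_mult[of m0 s V f t] assms(2,3) show ?thesis
    by (auto simp: vars_power_def)
qed

lemma primeideal_vars_power:
  "primeideal (vars_power A V 1) (poly_ring A :: (('v \<Rightarrow>\<^sub>0 nat) \<Rightarrow>\<^sub>0 'k::field) ring)"
proof (rule primeidealI[OF ideal_vars_power cring_poly_ring])
  have "1 \<notin> vars_power A V 1"
    by (simp add: vars_power_def vdeg_def)
  moreover have "1 \<in> carrier (poly_ring A :: (('v \<Rightarrow>\<^sub>0 nat) \<Rightarrow>\<^sub>0 'k) ring)"
    by (simp add: carrier_poly_ring_iff)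
  ultimately show "carrier (poly_ring A :: (('v \<Rightarrow>\<^sub>0 nat) \<Rightarrow>\<^sub>0 'k) ring) \<noteq> vars_power A V 1"
    by blast
next
  fix a b :: "('v \<Rightarrow>\<^sub>0 nat) \<Rightarrow>\<^sub>0 'k"
  assume "a \<in> carrier (poly_ring A)" "b \<in> carrier (poly_ring A)"
    and "a \<otimes>\<^bsub>poly_ring A\<^esub> b \<in> vars_power A V 1"
  with vars_power_cancel[of a A V b 1] show "a \<in> vars_power A V 1 \<or> b \<in> vars_power A V 1"
    by auto
qed

section \<open>Symbolic powers of edge ideals\<close>

lemma ideals_set_simps [simp]:
  "one (ideals_set R) = carrier R" "mult (ideals_set R) = ideal_prod R"
  by (simp_all add: ideals_set_def)

lemma (in ring) ideal_ideal_power: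
  assumes "ideal J R"
  shows "ideal (J [^]\<^bsub>ideals_set R\<^esub> (t::nat)) R"
  by (induction t) (simp_all add: oneideal ideal_prod_is_ideal assms)

lemma ideal_power_subset_vars_power:
  assumes "J \<subseteq> vars_power A V 1"
  shows "J [^]\<^bsub>ideals_set (poly_ring A)\<^esub> (t::nat) \<subseteq> vars_power A V t"
proof (induction t)
  case 0
  then show ?case
    by (auto simp: vars_power_def)
next
  case (Suc t)
  interpret ideal "vars_power A V (Suc t)" "poly_ring A"
    by (rule ideal_vars_power)
  have "f \<in> vars_power A V (Suc t)"
    if "f \<in> ideal_prod (poly_ring A) (J [^]\<^bsub>ideals_set (poly_ring A)\<^esub> t) J" for f
    using that
  proof induction
    case (prod i j)
    with Suc assms vars_power_mult[of i A V t j 1] show ?case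
      by auto
  next
    case (sum f g)
    then show ?case
      by (intro additive_subgroup.a_closed[OF is_additive_subgroup])
  qed
  then show ?case
    by auto
qed

section \<open>Minimal vertex covers\<close>

definition simple_graph :: "'v graph \<Rightarrow> bool" where
  "simple_graph G \<longleftrightarrow> finite (fst G) \<and>
     (\<forall>e\<in>snd G. \<exists>u v. e = {u, v} \<and> u \<noteq> v \<and> u \<in> fst G \<and> v \<in> fst G)"

definition vertex_cover :: "'v graph \<Rightarrow> 'v set \<Rightarrow> bool" where
  "vertex_cover G V \<longleftrightarrow> V \<subseteq> fst G \<and> (\<forall>e\<in>snd G. e \<inter> V \<noteq> {})"

text \<open>In a simple graph this is minimality under inclusion: \<open>v\<close> cannot be dropped
  from a cover iff some edge at \<open>v\<close> has its other end outside. The outside neighbour is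
  the form in which minimality is applied.\<close>

definition min_cover :: "'v graph \<Rightarrow> 'v set \<Rightarrow> bool" where
  "min_cover G V \<longleftrightarrow> vertex_cover G V \<and> (\<forall>v\<in>V. \<exists>u. {u, v} \<in> snd G \<and> u \<notin> V)"

text \<open>The covers pulled back from an odd cycle need not be minimal, while degree bounds are
  available for minimal covers only.\<close>

lemma vertex_cover_contains_min_cover:
  assumes "simple_graph G" "vertex_cover G V"
  obtains W where "min_cover G W" "W \<subseteq> V"
proof -
  have "finite V"
    using assms by (auto simp: simple_graph_def vertex_cover_def intro: finite_subset)
  then have "finite {W. vertex_cover G W \<and> W \<subseteq> V}"
    by (rule finite_subset[rotated, OF finite_Pow_iff[THEN iffD2]]) auto
  then obtain W where W: "vertex_cover G W" "W \<subseteq> V"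
    and min: "\<And>W'. \<lbrakk>vertex_cover G W'; W' \<subseteq> W\<rbrakk> \<Longrightarrow> W' = W"
    using finite_has_minimal2[of "{W. vertex_cover G W \<and> W \<subseteq> V}" V] assms(2) by auto blast
  have "\<exists>u. {u, v} \<in> snd G \<and> u \<notin> W" if v: "v \<in> W" for v
  proof -
    have "\<not> vertex_cover G (W - {v})"
      using min[of "W - {v}"] v by blast
    then obtain e where e: "e \<in> snd G" "e \<inter> (W - {v}) = {}"
      using W(1) by (auto simp: vertex_cover_def)
    then have "v \<in> e"
      using W(1) by (auto simp: vertex_cover_def)
    with e(1) assms(1) obtain u where "e = {u, v}" "u \<noteq> v"
      unfolding simple_graph_def by (metis insertE insert_commute singletonD)
    with e show ?thesis
      by auto
  qed
  with W that show ?thesis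
    by (auto simp: min_cover_def)
qed

lemma var_mult_var:
  "var u * var v = Poly_Mapping.single (Poly_Mapping.single u 1 + Poly_Mapping.single v 1) 1"
  by (simp add: var_def mult_single)

lemma var_in_poly_ring: "v \<in> A \<Longrightarrow> var v \<in> carrier (poly_ring A)"
  by (simp add: var_def single_in_poly_ring)

lemma single_single_mult_in_keys:
  fixes f :: "('v \<Rightarrow>\<^sub>0 nat) \<Rightarrow>\<^sub>0 'k::field"
  assumes "m \<in> Poly_Mapping.keys f"
  shows "m' + m \<in> Poly_Mapping.keys (Poly_Mapping.single m' 1 * f)"
  by (rule add_in_keys_mult) (use assms in auto)

section \<open>Associated primes and symbolic powers of the edge ideal\<close>

context
  fixes G :: "'v graph"
  assumes G: "simple_graph G"
begin

lemma edgeE: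
  assumes "e \<in> snd G"
  obtains u v where "e = {u, v}" "u \<noteq> v" "u \<in> fst G" "v \<in> fst G"
  using assms G by (auto simp: simple_graph_def)

lemma edge_gens_subset:
  "{var u * var v | u v. {u, v} \<in> snd G} \<subseteq> carrier (poly_ring (fst G))"
proof safe
  fix u v assume "{u, v} \<in> snd G"
  then have "u \<in> fst G \<and> v \<in> fst G"
    by (auto elim!: edgeE simp: doubleton_eq_iff)
  then show "var u * var v \<in> carrier (poly_ring (fst G))"
    by (intro mult_in_poly_ring var_in_poly_ring) auto
qed

lemma ideal_edge_ideal: "ideal (edge_ideal G) (poly_ring (fst G))"
  unfolding edge_ideal_def
  by (rule ring.genideal_ideal[OF cring.axioms(1)[OF cring_poly_ring] edge_gens_subset])

lemma edge_in_edge_ideal: "{u, v} \<in> snd G \<Longrightarrow> var u * var v \<in> edge_ideal G"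
  unfolding edge_ideal_def
  using ring.genideal_self[OF cring.axioms(1)[OF cring_poly_ring] edge_gens_subset] by blast

lemma edge_ideal_eq:
  "edge_ideal G = {f \<in> carrier (poly_ring (fst G) :: (('v \<Rightarrow>\<^sub>0 nat) \<Rightarrow>\<^sub>0 'k::field) ring).
     \<forall>m\<in>Poly_Mapping.keys f. \<exists>e\<in>snd G. e \<subseteq> Poly_Mapping.keys m}" (is "?I = ?J")
proof
  have "ideal ?J (poly_ring (fst G))"
    by (rule ideal_monomial_ideal) (auto simp: keys_add_nat)
  moreover have "{var u * var v | u v. {u, v} \<in> snd G} \<subseteq> ?J"
  proof safe
    fix u v assume uv: "{u, v} \<in> snd G"
    then show "var u * var v \<in> carrier (poly_ring (fst G))"
      using edge_gens_subset by blast
    fix m assume "m \<in> Poly_Mapping.keys (var u * var v :: ('v \<Rightarrow>\<^sub>0 nat) \<Rightarrow>\<^sub>0 'k)"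
    then have "Poly_Mapping.keys m = {u, v}"
      by (auto simp: var_mult_var keys_add_nat)
    with uv show "\<exists>e\<in>snd G. e \<subseteq> Poly_Mapping.keys m"
      by blast
  qed
  ultimately show "?I \<subseteq> ?J"
    unfolding edge_ideal_def
    by (rule ring.genideal_minimal[OF cring.axioms(1)[OF cring_poly_ring]])
next
  interpret I: ideal ?I "poly_ring (fst G)"
    by (rule ideal_edge_ideal)
  show "?J \<subseteq> ?I"
  proof
    fix f assume f: "f \<in> ?J"
    show "f \<in> ?I"
    proof (rule poly_in_idealI[OF ideal_edge_ideal])
      fix m assume m: "m \<in> Poly_Mapping.keys f"
      then obtain e where e: "e \<in> snd G" "e \<subseteq> Poly_Mapping.keys m"
        using f by blast
      from e(1) obtain u v where "e = {u, v}" "u \<noteq> v"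
        by (rule edgeE)
      with e have uv: "{u, v} \<in> snd G" "u \<noteq> v" "u \<in> Poly_Mapping.keys m" "v \<in> Poly_Mapping.keys m"
        by auto
      \<comment> \<open>Truncated subtraction of exponents is exact here: \<open>u\<close> and
        \<open>v\<close> are distinct and both divide the monomial.\<close>
      define m' where "m' = m - (Poly_Mapping.single u 1 + Poly_Mapping.single v 1)"
      have m_eq: "m = m' + (Poly_Mapping.single u 1 + Poly_Mapping.single v 1)"
        using uv by (intro poly_mapping_eqI)
          (auto simp: m'_def lookup_add lookup_minus lookup_single when_def in_keys_iff)
      have "Poly_Mapping.keys m \<subseteq> fst G"
        using f m by (auto simp: carrier_poly_ring_iff)
      then have "Poly_Mapping.keys m' \<subseteq> fst G"
        by (subst (asm) m_eq) (simp add: keys_add_nat)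
      then have "Poly_Mapping.single m' 1 * (var u * var v) \<in> ?I"
        using I.I_l_closed[OF edge_in_edge_ideal[OF uv(1)]] by (simp add: single_in_poly_ring)
      then show "Poly_Mapping.single m 1 \<in> ?I"
        by (subst m_eq) (simp add: var_mult_var mult_single)
    qed
  qed
qed

lemma min_coverD:
  assumes "min_cover G V"
  shows "V \<subseteq> fst G" "finite V" "\<And>e. e \<in> snd G \<Longrightarrow> e \<inter> V \<noteq> {}"
    "\<And>v. v \<in> V \<Longrightarrow> \<exists>u. {u, v} \<in> snd G \<and> u \<notin> V"
  using assms G by (auto simp: min_cover_def vertex_cover_def simple_graph_def intro: finite_subset)

lemma edge_ideal_subset_vars_power:
  assumes "min_cover G V"
  shows "edge_ideal G \<subseteq> vars_power (fst G) V 1"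
proof
  fix f :: "('v \<Rightarrow>\<^sub>0 nat) \<Rightarrow>\<^sub>0 'k::field"
  assume f: "f \<in> edge_ideal G"
  have "1 \<le> vdeg V m" if m: "m \<in> Poly_Mapping.keys f" for m
  proof -
    obtain e where "e \<in> snd G" "e \<subseteq> Poly_Mapping.keys m"
      using f m by (auto simp: edge_ideal_eq)
    with min_coverD(3)[OF assms] have "Poly_Mapping.keys m \<inter> V \<noteq> {}"
      by blast
    then have "vdeg V m \<noteq> 0"
      using vdeg_eq_0_iff[OF min_coverD(2)[OF assms]] by blast
    then show ?thesis
      by simp
  qed
  with f show "f \<in> vars_power (fst G) V 1"
    by (simp add: vars_power_def edge_ideal_eq)
qed

text \<open>The prime of a minimal cover \<open>V\<close> annihilates the product of the vertices outside \<open>V\<close>.\<close>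

lemma vars_power_in_assoc_primes:
  assumes V: "min_cover G V"
  shows "vars_power (fst G) V 1 \<in>
    assoc_primes (poly_ring (fst G)) (edge_ideal G :: (('v \<Rightarrow>\<^sub>0 nat) \<Rightarrow>\<^sub>0 'k::field) set)"
proof -
  let ?R = "poly_ring (fst G) :: (('v \<Rightarrow>\<^sub>0 nat) \<Rightarrow>\<^sub>0 'k) ring"
  have fin: "finite (fst G)"
    using G by (simp add: simple_graph_def)
  define \<mu> :: "'v \<Rightarrow>\<^sub>0 nat" where "\<mu> = (\<Sum>v\<in>fst G - V. Poly_Mapping.single v 1)"
  have "Poly_Mapping.lookup \<mu> v = (if v \<in> fst G - V then 1 else 0)" for v
    using fin by (simp add: \<mu>_def lookup_sum lookup_single when_def)
  then have keys: "Poly_Mapping.keys \<mu> = fst G - V"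
    by (auto simp: in_keys_iff split: if_splits)
  define f :: "('v \<Rightarrow>\<^sub>0 nat) \<Rightarrow>\<^sub>0 'k" where "f = Poly_Mapping.single \<mu> 1"
  have f: "f \<in> carrier ?R"
    unfolding f_def using keys by (intro single_in_poly_ring) auto
  \<comment> \<open>The support of \<open>\<mu>\<close> contains no edge because \<open>V\<close> is
    a cover. A vertex of \<open>V\<close> in \<open>m\<close> creates one, since minimality gives it
    a neighbour outside \<open>V\<close>, that is, in the support of \<open>\<mu>\<close>.\<close>
  have contains_edge: "(\<exists>e\<in>snd G. e \<subseteq> Poly_Mapping.keys (\<mu> + m)) \<longleftrightarrow> 1 \<le> vdeg V m"
    if m: "Poly_Mapping.keys m \<subseteq> fst G" for m
  proof
    assume "\<exists>e\<in>snd G. e \<subseteq> Poly_Mapping.keys (\<mu> + m)"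
    then obtain e where e: "e \<in> snd G" "e \<subseteq> (fst G - V) \<union> Poly_Mapping.keys m"
      by (auto simp: keys_add_nat keys)
    with min_coverD(3)[OF V e(1)] have "Poly_Mapping.keys m \<inter> V \<noteq> {}"
      by blast
    then show "1 \<le> vdeg V m"
      using vdeg_eq_0_iff[OF min_coverD(2)[OF V], of m] by linarith
  next
    assume "1 \<le> vdeg V m"
    then obtain v where v: "v \<in> V" "v \<in> Poly_Mapping.keys m"
      using vdeg_eq_0_iff[OF min_coverD(2)[OF V], of m] by force
    then obtain u where u: "{u, v} \<in> snd G" "u \<notin> V"
      using min_coverD(4)[OF V] by blast
    then have "u \<in> fst G"
      by (auto elim!: edgeE simp: doubleton_eq_iff)
    with u v show "\<exists>e\<in>snd G. e \<subseteq> Poly_Mapping.keys (\<mu> + m)"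
      by (intro bexI[of _ "{u, v}"]) (auto simp: keys_add_nat keys)
  qed
  have "r \<in> vars_power (fst G) V 1 \<longleftrightarrow> r * f \<in> edge_ideal G" if r: "r \<in> carrier ?R" for r
  proof -
    have keys_r: "Poly_Mapping.keys m \<subseteq> fst G" if "m \<in> Poly_Mapping.keys r" for m
      using r that by (auto simp: carrier_poly_ring_iff)
    \<comment> \<open>Multiplication by one monomial shifts all exponents injectively, so no terms
      of \<open>r\<close> cancel.\<close>
    have "Poly_Mapping.keys (f * r) = (+) \<mu> ` Poly_Mapping.keys r"
      using keys_mult[of f r] single_single_mult_in_keys[of _ r \<mu>] by (auto simp: f_def)
    then show ?thesis
      using r f keys_r contains_edge
      by (auto simp: vars_power_def edge_ideal_eq mult.commute[of r f] mult_in_poly_ring)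
  qed
  then have "vars_power (fst G) V 1 = {r \<in> carrier ?R. r \<otimes>\<^bsub>?R\<^esub> f \<in> edge_ideal G}"
    by (auto simp: vars_power_def)
  with f show ?thesis
    unfolding assoc_primes_def using primeideal_vars_power by blast
qed

text \<open>Covering follows from primality, as \<open>p\<close> contains the product of the ends of
  each edge. For minimality write \<open>p\<close> as the annihilator of \<open>f\<close> modulo the
  edge ideal. As \<open>f\<close> lies outside that ideal, it has a monomial \<open>\<mu>\<close>
  whose support contains no edge. If the variable of \<open>v\<close> is in \<open>p\<close>,
  multiplying \<open>\<mu>\<close> by it creates an edge, which joins \<open>v\<close> to some
  \<open>u\<close> in the support of \<open>\<mu>\<close>.\<close>

lemma assoc_prime_min_cover:
  assumes "p \<in> assoc_primes (poly_ring (fst G)) (edge_ideal G :: (('v \<Rightarrow>\<^sub>0 nat) \<Rightarrow>\<^sub>0 'k::field) set)"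
  shows "min_cover G {v \<in> fst G. var v \<in> p}" (is "min_cover G ?V")
proof -
  let ?R = "poly_ring (fst G) :: (('v \<Rightarrow>\<^sub>0 nat) \<Rightarrow>\<^sub>0 'k) ring"
  obtain f where "primeideal p ?R" and f: "f \<in> carrier ?R"
    and p: "p = {r \<in> carrier ?R. r * f \<in> edge_ideal G}"
    using assms by (auto simp: assoc_primes_def)
  interpret primeideal p ?R by fact
  interpret I: ideal "edge_ideal G" ?R by (rule ideal_edge_ideal)
  have "f \<notin> edge_ideal G"
  proof
    assume "f \<in> edge_ideal G"
    moreover have "1 \<in> carrier ?R"
      by (simp add: carrier_poly_ring_iff)
    ultimately have "1 \<in> p"
      unfolding p mem_Collect_eq by simp
    then show False
      using one_notin_prime by simp
  qed
  then have "\<exists>\<mu>\<in>Poly_Mapping.keys f. \<forall>e\<in>snd G. \<not> e \<subseteq> Poly_Mapping.keys \<mu>"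
    using f unfolding edge_ideal_eq by blast
  then obtain \<mu> where \<mu>: "\<mu> \<in> Poly_Mapping.keys f"
    and indep: "\<And>e. e \<in> snd G \<Longrightarrow> \<not> e \<subseteq> Poly_Mapping.keys \<mu>"
    by blast
  have edge: "\<exists>e\<in>snd G. e \<subseteq> insert v (Poly_Mapping.keys \<mu>)" if "var v \<in> p" for v
  proof -
    have "Poly_Mapping.single v 1 + \<mu> \<in> Poly_Mapping.keys (var v * f)"
      unfolding var_def by (rule single_single_mult_in_keys[OF \<mu>])
    moreover have "var v * f \<in> edge_ideal G"
      using that unfolding p by blast
    ultimately have "\<exists>e\<in>snd G. e \<subseteq> Poly_Mapping.keys (Poly_Mapping.single v 1 + \<mu>)"
      unfolding edge_ideal_eq by blast
    then show ?thesis
      by (simp add: keys_add_nat)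
  qed
  have "e \<inter> ?V \<noteq> {}" if e: "e \<in> snd G" for e
  proof -
    obtain u v where uv: "e = {u, v}" "u \<in> fst G" "v \<in> fst G"
      using e by (rule edgeE)
    then have "var u * var v \<in> edge_ideal G"
      using edge_in_edge_ideal e by simp
    then have "(var u * var v) * f \<in> edge_ideal G"
      using I.I_r_closed[of "var u * var v" f] f by simp
    moreover have "var u * var v \<in> carrier ?R"
      using uv by (simp add: mult_in_poly_ring var_in_poly_ring)
    ultimately have "var u * var v \<in> p"
      unfolding p by blast
    then have "var u \<in> p \<or> var v \<in> p"
      using I_prime[of "var u" "var v"] uv by (simp add: var_in_poly_ring)
    with uv show ?thesis
      by auto
  qed
  moreover have "\<exists>u. {u, v} \<in> snd G \<and> u \<notin> ?V" if v: "v \<in> ?V" for v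
  proof -
    obtain e where e: "e \<in> snd G" "e \<subseteq> insert v (Poly_Mapping.keys \<mu>)"
      using edge v by blast
    then have "v \<in> e"
      using indep by blast
    with e(1) obtain u where u: "e = {u, v}" "u \<noteq> v"
      by (metis edgeE insertE insert_commute singletonD)
    then have "u \<in> Poly_Mapping.keys \<mu>"
      using e by blast
    \<comment> \<open>Multiplying \<open>\<mu>\<close> by the variable of \<open>u\<close> leaves
      its support unchanged and hence free of edges, so this variable is not in
      \<open>p\<close>.\<close>
    then have "insert u (Poly_Mapping.keys \<mu>) = Poly_Mapping.keys \<mu>"
      by blast
    then have "var u \<notin> p"
      using edge[of u] indep by auto
    with e u show ?thesis
      by blast
  qed
  ultimately show ?thesis
    by (auto simp: min_cover_def vertex_cover_def)
qed

text \<open>Each factor \<open>w\<close> is paired with one variable of \<open>V\<close> dividing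
  the monomial, which yields one element of the edge ideal; degree \<open>t\<close> in
  \<open>V\<close> allows \<open>t\<close> such pairings.\<close>

lemma single_in_ideal_power:
  fixes w :: "('v \<Rightarrow>\<^sub>0 nat) \<Rightarrow>\<^sub>0 'k::field"
  assumes w: "\<And>v. v \<in> V \<Longrightarrow> w * var v \<in> edge_ideal G" "w \<in> carrier (poly_ring (fst G))"
    and m: "Poly_Mapping.keys m \<subseteq> fst G" "t \<le> vdeg V m"
  shows "w ^ t * Poly_Mapping.single m 1 \<in> edge_ideal G [^]\<^bsub>ideals_set (poly_ring (fst G))\<^esub> t"
  using m
proof (induction t arbitrary: m)
  case 0
  then show ?case
    by (simp add: single_in_poly_ring)
next
  case (Suc t)
  have "vdeg V m \<noteq> 0"
    using Suc.prems by simp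
  \<comment> \<open>A sum over an infinite set is 0 by convention, so a nonzero \<open>vdeg\<close>
    also gives finiteness.\<close>
  then have "finite V" "\<exists>v\<in>V. Poly_Mapping.lookup m v \<noteq> 0"
    unfolding vdeg_def by (metis sum.infinite, metis sum.neutral)
  then obtain v where v: "v \<in> V" "Poly_Mapping.lookup m v \<noteq> 0"
    by blast
  define m' where "m' = m - Poly_Mapping.single v 1"
  have m_eq: "m = m' + Poly_Mapping.single v 1"
    using v by (intro poly_mapping_eqI)
      (auto simp: m'_def lookup_add lookup_minus lookup_single when_def)
  have "Poly_Mapping.keys m' \<subseteq> fst G" "t \<le> vdeg V m'"
    using Suc.prems v(1) \<open>finite V\<close>
    by (subst (asm) (1 2) m_eq, simp add: keys_add_nat vdeg_add vdeg_single)+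
  then have "(w ^ t * Poly_Mapping.single m' 1) * (w * var v) \<in>
      edge_ideal G [^]\<^bsub>ideals_set (poly_ring (fst G))\<^esub> Suc t"
    unfolding nat_pow_Suc ideals_set_simps
    using ideal_prod.prod[OF Suc.IH w(1)[OF v(1)], of m' "poly_ring (fst G)"] by simp
  also have "(w ^ t * Poly_Mapping.single m' 1) * (w * var v) =
      w ^ Suc t * (Poly_Mapping.single m' 1 * var v)"
    by (simp add: ac_simps)
  also have "Poly_Mapping.single m' 1 * var v = Poly_Mapping.single m 1"
    by (subst m_eq) (simp add: var_def mult_single)
  finally show ?case .
qed

text \<open>The multiplier is \<open>w ^ t\<close>, where \<open>w\<close> is the product of one
  neighbour \<open>h v\<close> outside the cover for each cover vertex \<open>v\<close>. No factor
  lies in the prime \<open>p\<close>, hence neither does \<open>w ^ t\<close>, while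
  \<open>w\<close> times any variable of the cover is a multiple of an edge.\<close>

lemma vars_power_subset_loc_contraction:
  assumes p: "p \<in> assoc_primes (poly_ring (fst G)) (edge_ideal G :: (('v \<Rightarrow>\<^sub>0 nat) \<Rightarrow>\<^sub>0 'k::field) set)"
    and f: "f \<in> vars_power (fst G) {v \<in> fst G. var v \<in> p} t" (is "f \<in> vars_power _ ?V _")
  shows "f \<in> loc_contraction (poly_ring (fst G)) p
    (edge_ideal G [^]\<^bsub>ideals_set (poly_ring (fst G))\<^esub> t)"
proof -
  let ?R = "poly_ring (fst G) :: (('v \<Rightarrow>\<^sub>0 nat) \<Rightarrow>\<^sub>0 'k) ring"
  interpret primeideal p ?R
    using p by (simp add: assoc_primes_def)
  interpret I: ideal "edge_ideal G" ?R by (rule ideal_edge_ideal)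
  note ideal_power = ideal_ideal_power[OF ideal_edge_ideal, of t]
  have V: "min_cover G ?V"
    by (rule assoc_prime_min_cover[OF p])
  have "\<exists>h. \<forall>v\<in>?V. {h v, v} \<in> snd G \<and> h v \<notin> ?V"
    by (intro bchoice ballI min_coverD(4)[OF V])
  then obtain h where h: "\<And>v. v \<in> ?V \<Longrightarrow> {h v, v} \<in> snd G \<and> h v \<notin> ?V"
    by blast
  then have h': "h v \<in> fst G" if "v \<in> ?V" for v
    using that by (metis edgeE doubleton_eq_iff)
  have mult_compl: "a * b \<in> carrier ?R - p" if "a \<in> carrier ?R - p" "b \<in> carrier ?R - p" for a b
    using mult_closed_compl[OF that] by simp
  have one_compl': "1 \<in> carrier ?R - p"
    using one_compl by simp
  have prod_compl: "(\<Prod>v\<in>W. var (h v)) \<in> carrier ?R - p" if "W \<subseteq> ?V" for W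
  proof -
    have "finite W"
      using that min_coverD(2)[OF V] by (rule finite_subset)
    then show ?thesis
      using that
    proof (induction W rule: finite_induct)
      case empty
      then show ?case
        using one_compl' by simp
    next
      case (insert v W)
      then have "v \<in> ?V"
        by blast
      then have "var (h v) \<in> carrier ?R - p"
        using h[of v] h'[of v] by (auto simp: var_in_poly_ring)
      with insert mult_compl show ?case
        by simp
    qed
  qed
  define w :: "('v \<Rightarrow>\<^sub>0 nat) \<Rightarrow>\<^sub>0 'k" where "w = (\<Prod>v\<in>?V. var (h v))"
  have w: "w \<in> carrier ?R - p"
    unfolding w_def by (rule prod_compl) simp
  have wt: "w ^ t \<in> carrier ?R - p"
    using w mult_compl one_compl' by (induction t) auto
  have w_var: "w * var v \<in> edge_ideal G" if v: "v \<in> ?V" for v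
  proof -
    let ?q = "(\<Prod>v\<in>?V - {v}. var (h v)) :: ('v \<Rightarrow>\<^sub>0 nat) \<Rightarrow>\<^sub>0 'k"
    have "w * var v = ?q * (var (h v) * var v)"
      unfolding w_def by (subst prod.remove[OF min_coverD(2)[OF V] v]) (simp only: ac_simps)
    moreover have "?q \<in> carrier ?R"
      using prod_compl[of "?V - {v}"] by blast
    ultimately show ?thesis
      using I.I_l_closed[OF edge_in_edge_ideal, of "h v" v ?q] h[OF v] by simp
  qed
  have fR: "f \<in> carrier ?R"
    using f by (simp add: vars_power_def)
  have "w ^ t * f \<in> edge_ideal G [^]\<^bsub>ideals_set ?R\<^esub> t"
  proof (rule mult_in_idealI[OF ideal_power])
    fix m assume "m \<in> Poly_Mapping.keys f"
    then have "Poly_Mapping.keys m \<subseteq> fst G" "t \<le> vdeg ?V m"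
      using f by (auto simp: vars_power_def carrier_poly_ring_iff)
    with w w_var show "w ^ t * Poly_Mapping.single m 1 \<in> edge_ideal G [^]\<^bsub>ideals_set ?R\<^esub> t"
      by (intro single_in_ideal_power[of ?V]) auto
  qed
  with wt fR show ?thesis
    unfolding loc_contraction_eq[OF ideal_power] by auto
qed

theorem symbolic_power_edge_ideal:
  "symbolic_power (poly_ring (fst G)) (edge_ideal G :: (('v \<Rightarrow>\<^sub>0 nat) \<Rightarrow>\<^sub>0 'k::field) set) t =
     {f \<in> carrier (poly_ring (fst G)).
        \<forall>V. min_cover G V \<longrightarrow> (\<forall>m\<in>Poly_Mapping.keys f. t \<le> vdeg V m)}" (is "?S = ?T")
proof
  let ?R = "poly_ring (fst G) :: (('v \<Rightarrow>\<^sub>0 nat) \<Rightarrow>\<^sub>0 'k) ring"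
  let ?I = "edge_ideal G :: (('v \<Rightarrow>\<^sub>0 nat) \<Rightarrow>\<^sub>0 'k) set"
  have ideal_power: "ideal (?I [^]\<^bsub>ideals_set ?R\<^esub> t) ?R"
    by (intro ring.ideal_ideal_power cring.axioms(1) cring_poly_ring ideal_edge_ideal)
  show "?S \<subseteq> ?T"
  proof
    fix f assume f: "f \<in> ?S"
    have "f \<in> vars_power (fst G) V t" if V: "min_cover G V" for V
    proof -
      have "f \<in> loc_contraction ?R (vars_power (fst G) V 1) (?I [^]\<^bsub>ideals_set ?R\<^esub> t)"
        using f vars_power_in_assoc_primes[OF V] by (auto simp: symbolic_power_def)
      then obtain s where s: "f \<in> carrier ?R" "s \<in> carrier ?R - vars_power (fst G) V 1"
        "s * f \<in> ?I [^]\<^bsub>ideals_set ?R\<^esub> t"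
        unfolding primeideal.loc_contraction_eq[OF primeideal_vars_power ideal_power] by auto
      then have "s * f \<in> vars_power (fst G) V t"
        using ideal_power_subset_vars_power[OF edge_ideal_subset_vars_power[OF V]] by blast
      then show ?thesis
        by (rule vars_power_cancel[OF s(2,1)])
    qed
    with f show "f \<in> ?T"
      by (auto simp: vars_power_def symbolic_power_def)
  qed
  show "?T \<subseteq> ?S"
  proof
    fix f assume f: "f \<in> ?T"
    have "f \<in> loc_contraction ?R p (?I [^]\<^bsub>ideals_set ?R\<^esub> t)" if p: "p \<in> assoc_primes ?R ?I" for p
      using f assoc_prime_min_cover[OF p]
      by (intro vars_power_subset_loc_contraction[OF p]) (auto simp: vars_power_def)
    with f show "f \<in> ?S"
      by (auto simp: symbolic_power_def)
  qed
qed

end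

section \<open>Two odd cycles sharing a vertex\<close>

lemma vdeg_sum: "vdeg V (sum f K) = (\<Sum>i\<in>K. vdeg V (f i))"
proof (induction K rule: infinite_finite_induct)
  case (insert x K)
  then show ?case
    by (simp add: vdeg_add)
qed (simp_all add: vdeg_def)

lemma monom_degree_eq_vdeg:
  "finite F \<Longrightarrow> Poly_Mapping.keys m \<subseteq> F \<Longrightarrow> monom_degree m = vdeg F m"
  unfolding monom_degree_def vdeg_def by (rule sum.mono_neutral_left) (auto simp: in_keys_iff)

lemma alpha_eqI:
  fixes J :: "(('v \<Rightarrow>\<^sub>0 nat) \<Rightarrow>\<^sub>0 'k::field) set"
  assumes "Poly_Mapping.single \<mu> 1 \<in> J"
    and "\<And>f m. \<lbrakk>f \<in> J; m \<in> Poly_Mapping.keys f\<rbrakk> \<Longrightarrow> monom_degree \<mu> \<le> monom_degree m"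
  shows "alpha J = monom_degree \<mu>"
  unfolding alpha_def
proof (rule Least_equality)
  show "\<exists>f\<in>J. f \<noteq> 0 \<and> total_degree f = monom_degree \<mu>"
    using assms(1) by (intro bexI[of _ "Poly_Mapping.single \<mu> 1"])
      (auto simp: total_degree_def simp flip: keys_eq_empty)
next
  fix d assume "\<exists>f\<in>J. f \<noteq> 0 \<and> total_degree f = d"
  then obtain f where f: "f \<in> J" "f \<noteq> 0" "d = total_degree f"
    by blast
  have "Poly_Mapping.keys f \<noteq> {}"
    using f(2) by (simp flip: keys_eq_empty)
  then obtain m where m: "m \<in> Poly_Mapping.keys f"
    by blast
  have "monom_degree \<mu> \<le> monom_degree m"
    using f(1) m by (rule assms(2))
  also have "\<dots> \<le> d"
    unfolding f(3) total_degree_def using m by simp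
  finally show "monom_degree \<mu> \<le> d" .
qed

text \<open>The residues 1, 3, ..., 2n-1 together with 2n cover the cycle of residues mod 2n+1.
  Adding \<open>a\<close> permutes residues, so the number of rotations \<open>i\<close> that place
  \<open>a\<close> in this set is bounded by its size.\<close>

lemma card_odd_or_last:
  "card {i. i < 2 * n + 1 \<and> (odd ((a + i) mod (2 * n + 1)) \<or> (a + i) mod (2 * n + 1) = 2 * n)} \<le> n + 1"
    (is "card ?A \<le> _")
proof -
  let ?S = "insert (2 * n) ((\<lambda>k. 2 * k + 1) ` {..<n})"
  have "inj_on (\<lambda>i. (a + i) mod (2 * n + 1)) ?A"
  proof (rule inj_onI)
    fix i j assume ij: "i \<in> ?A" "j \<in> ?A" "(a + i) mod (2 * n + 1) = (a + j) mod (2 * n + 1)"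
    have inj: "k = l" if "k \<le> l" "l < 2 * n + 1" "(a + l) mod (2 * n + 1) = (a + k) mod (2 * n + 1)"
      for k l
    proof -
      have "2 * n + 1 dvd l - k"
        using that mod_eq_dvd_iff_nat[of "a + k" "a + l" "2 * n + 1"] by simp
      then show ?thesis
        using that(1,2) by (auto dest: dvd_imp_le)
    qed
    show "i = j"
      using inj[of i j] inj[of j i] ij by (cases "i \<le> j") auto
  qed
  moreover have "(\<lambda>i. (a + i) mod (2 * n + 1)) ` ?A \<subseteq> ?S"
  proof safe
    fix i assume "odd ((a + i) mod (2 * n + 1))" "(a + i) mod (2 * n + 1) \<notin> (\<lambda>k. 2 * k + 1) ` {..<n}"
    then obtain k where k: "(a + i) mod (2 * n + 1) = 2 * k + 1"
      by (elim oddE)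
    moreover have "(a + i) mod (2 * n + 1) < 2 * n + 1"
      by simp
    ultimately have "k < n"
      by linarith
    with k show "(a + i) mod (2 * n + 1) = 2 * n"
      using \<open>_ \<notin> _\<close> by blast
  qed
  ultimately have "card ?A \<le> card ?S"
    by (intro card_inj_on_le) auto
  also have "\<dots> \<le> Suc (card ((\<lambda>k. 2 * k + 1) ` {..<n}))"
    by (rule card_insert_le_m1) auto
  also have "\<dots> \<le> n + 1"
    using card_image_le[of "{..<n}" "\<lambda>k. 2 * k + 1"] by simp
  finally show ?thesis .
qed

text \<open>
  A homomorphism to an odd cycle pulls back the \<open>2n + 1\<close> rotations of a vertex cover with
  \<open>n + 1\<close> elements to vertex covers that contain every vertex equally often; averaging the degree
  bounds over them gives the estimate.
\<close>

lemma monom_degree_ge_of_hom_odd_cycle: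
  assumes G: "simple_graph G"
    and hom: "\<And>u v. {u, v} \<in> snd G \<Longrightarrow>
      \<phi> v = Suc (\<phi> u) mod (2 * n + 1) \<or> \<phi> u = Suc (\<phi> v) mod (2 * n + 1)"
    and m: "Poly_Mapping.keys m \<subseteq> fst G" "\<And>V. min_cover G V \<Longrightarrow> t \<le> vdeg V m"
  shows "(2 * n + 1) * t \<le> (n + 1) * monom_degree m"
proof -
  define N where "N = 2 * n + 1"
  \<comment> \<open>The cover of residues rotated by \<open>i\<close> and pulled back along
    \<open>\<phi>\<close>. The residue 2n is included because 2n and 0 are adjacent and both
    even.\<close>
  define W where "W i = {v \<in> fst G. odd ((\<phi> v + i) mod N) \<or> (\<phi> v + i) mod N = 2 * n}" for i
  have fin: "finite (fst G)"
    using G by (simp add: simple_graph_def)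
  \<comment> \<open>Moving to the next residue changes parity except when leaving 2n, which itself
    belongs to the cover.\<close>
  have step: "u \<in> W i \<or> v \<in> W i" if "u \<in> fst G" "v \<in> fst G" "\<phi> v = Suc (\<phi> u) mod N" for u v i
  proof (rule disjCI)
    assume "v \<notin> W i"
    have "(\<phi> v + i) mod N = Suc ((\<phi> u + i) mod N) mod N"
      unfolding that(3) by (simp add: mod_simps)
    moreover have "Suc ((\<phi> u + i) mod N) mod N = Suc ((\<phi> u + i) mod N)"
      if "(\<phi> u + i) mod N \<noteq> 2 * n"
    proof (rule mod_less)
      have "(\<phi> u + i) mod N < N"
        by (simp add: N_def)
      with that show "Suc ((\<phi> u + i) mod N) < N"
        unfolding N_def by linarith
    qed
    ultimately show "u \<in> W i"
      using that(1,2) \<open>v \<notin> W i\<close> unfolding W_def mem_Collect_eq by (metis even_Suc)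
  qed
  have "t \<le> vdeg (W i) m" for i
  proof -
    have "vertex_cover G (W i)"
      unfolding vertex_cover_def
    proof safe
      fix e assume e: "e \<in> snd G" "e \<inter> W i = {}"
      with G obtain u v where uv: "e = {u, v}" "u \<in> fst G" "v \<in> fst G"
        by (auto simp: simple_graph_def)
      with e hom[of u v] step[of u v i] step[of v u i] show False
        by (auto simp: N_def)
    qed (auto simp: W_def)
    with G obtain V where V: "min_cover G V" "V \<subseteq> W i"
      by (rule vertex_cover_contains_min_cover)
    have "t \<le> vdeg V m"
      using V(1) by (rule m(2))
    also have "\<dots> \<le> vdeg (W i) m"
      unfolding vdeg_def using V(2) fin by (intro sum_mono2) (auto simp: W_def)
    finally show ?thesis .
  qed
  then have "(2 * n + 1) * t \<le> (\<Sum>i<N. vdeg (W i) m)"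
    using sum_bounded_below[of "{..<N}" t "\<lambda>i. vdeg (W i) m"]
    unfolding N_def card_lessThan of_nat_id by blast
  also have "\<dots> = (\<Sum>i<N. \<Sum>v\<in>fst G. if v \<in> W i then Poly_Mapping.lookup m v else 0)"
    using fin by (simp add: vdeg_def W_def flip: sum.inter_filter)
  \<comment> \<open>Double counting: after exchanging the sums, each exponent is weighted by the
    number of rotations whose cover contains the vertex.\<close>
  also have "\<dots> = (\<Sum>v\<in>fst G. Poly_Mapping.lookup m v * card {i. i < N \<and> v \<in> W i})"
    by (subst sum.swap) (simp add: sum.If_cases Int_def conj_commute mult.commute)
  also have "\<dots> \<le> (\<Sum>v\<in>fst G. Poly_Mapping.lookup m v * (n + 1))"
    using card_odd_or_last[of n] by (intro sum_mono mult_left_mono) (auto simp: W_def N_def)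
  also have "\<dots> = (n + 1) * monom_degree m"
    unfolding monom_degree_eq_vdeg[OF fin m(1)] vdeg_def by (simp only: sum_distrib_left mult.commute)
  finally show ?thesis .
qed

text \<open>The longer cycle runs once through the residues 0, ..., 2n and spends its remaining even
  number of vertices bouncing between 2n-1 and 2n. It thus ends at 2n, adjacent to 0, and both
  cycles send the shared vertex to 0.\<close>

lemma double_odd_cycle_hom:
  assumes "1 \<le> n" "n \<le> m" "distinct C1" "length C1 = 2 * n + 1"
    and "distinct C2" "length C2 = 2 * m + 1"
    and "hd C2 = hd C1" "set C1 \<inter> set C2 = {hd C1}"
  obtains \<phi> :: "'v \<Rightarrow> nat" where
    "\<And>u v. {u, v} \<in> snd (graph_union (cycle_graph C1) (cycle_graph C2)) \<Longrightarrow>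
      \<phi> v = Suc (\<phi> u) mod (2 * n + 1) \<or> \<phi> u = Suc (\<phi> v) mod (2 * n + 1)"
proof -
  define idx where "idx C v = (THE i. i < length C \<and> C ! i = v)" for C :: "'v list" and v
  have idx: "idx C (C ! i) = i" if "distinct C" "i < length C" for C i
    unfolding idx_def using that by (intro the_equality) (auto simp: nth_eq_iff_index_eq)
  define g where "g j = (if j \<le> 2 * n then j else if even j then 2 * n else 2 * n - 1)" for j
  define \<phi> where "\<phi> v = (if v \<in> set C1 then idx C1 v else g (idx C2 v))" for v
  have \<phi>1: "\<phi> (C1 ! i) = i" if "i < 2 * n + 1" for i
    using that assms by (simp add: \<phi>_def idx)
  have \<phi>2: "\<phi> (C2 ! j) = g j" if j: "j < 2 * m + 1" for j
  proof (cases "C2 ! j \<in> set C1")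
    case True
    have "C1 \<noteq> []" "C2 \<noteq> []"
      using assms(4,6) by auto
    then have hd: "hd C1 = C1 ! 0" "hd C2 = C2 ! 0"
      by (simp_all add: hd_conv_nth)
    have "C2 ! j \<in> set C1 \<inter> set C2"
      using True j assms(6) by simp
    then have "C2 ! j = C2 ! 0"
      unfolding assms(8) hd(2)[symmetric] assms(7) by simp
    then have "j = 0"
      using j assms(5,6) by (simp add: nth_eq_iff_index_eq)
    then show ?thesis
      using \<phi>1[of 0] hd assms(7) by (simp add: g_def)
  next
    case False
    then show ?thesis
      using j assms by (simp add: \<phi>_def idx)
  qed
  have g: "g (Suc j mod (2 * m + 1)) = Suc (g j) mod (2 * n + 1) \<or>
      g j = Suc (g (Suc j mod (2 * m + 1))) mod (2 * n + 1)" if j: "j < 2 * m + 1" for j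
  proof (cases "j = 2 * m")
    case True
    \<comment> \<open>The closing edge returns to position 0. Since 2m is even and at least 2n, the
      last position is sent to 2n, which precedes 0 modulo 2n+1.\<close>
    then have "g j = 2 * n"
      using assms(2) by (auto simp: g_def)
    with True show ?thesis
      by (simp add: g_def)
  next
    case False
    with j have Suc_j: "Suc j mod (2 * m + 1) = Suc j"
      by simp
    consider "j < 2 * n" | "j = 2 * n" | "2 * n < j"
      by linarith
    then show ?thesis
      unfolding Suc_j using assms(1) by cases (simp_all add: g_def)
  qed
  have "\<phi> v = Suc (\<phi> u) mod (2 * n + 1) \<or> \<phi> u = Suc (\<phi> v) mod (2 * n + 1)"
    if "{u, v} \<in> snd (graph_union (cycle_graph C1) (cycle_graph C2))" for u v
  proof -
    have "(\<exists>i<2 * n + 1. {u, v} = {C1 ! i, C1 ! (Suc i mod (2 * n + 1))}) \<or>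
        (\<exists>j<2 * m + 1. {u, v} = {C2 ! j, C2 ! (Suc j mod (2 * m + 1))})"
      using that assms by (auto simp: graph_union_def cycle_graph_def)
    then show ?thesis
    proof (elim disjE exE conjE)
      fix i assume "i < 2 * n + 1" "{u, v} = {C1 ! i, C1 ! (Suc i mod (2 * n + 1))}"
      moreover from this have "\<phi> (C1 ! i) = i"
        "\<phi> (C1 ! (Suc i mod (2 * n + 1))) = Suc i mod (2 * n + 1)"
        using \<phi>1[of i] \<phi>1[of "Suc i mod (2 * n + 1)"] by simp_all
      ultimately show ?thesis
        by (auto simp: doubleton_eq_iff simp del: mod_Suc)
    next
      fix j assume "j < 2 * m + 1" "{u, v} = {C2 ! j, C2 ! (Suc j mod (2 * m + 1))}"
      moreover from this have "\<phi> (C2 ! j) = g j"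
        "\<phi> (C2 ! (Suc j mod (2 * m + 1))) = g (Suc j mod (2 * m + 1))"
        using \<phi>2[of j] \<phi>2[of "Suc j mod (2 * m + 1)"] by simp_all
      ultimately show ?thesis
        using g[of j] by (auto simp: doubleton_eq_iff)
    qed
  qed
  then show ?thesis
    by (rule that)
qed

section \<open>The union of two cycles as a simple graph\<close>

lemma cycle_graph_edge:
  assumes "distinct C" "3 \<le> length C" "e \<in> snd (cycle_graph C)"
  shows "\<exists>u v. e = {u, v} \<and> u \<noteq> v \<and> u \<in> set C \<and> v \<in> set C"
proof -
  obtain i where i: "i < length C" "e = {C ! i, C ! (Suc i mod length C)}"
    using assms(3) by (auto simp: cycle_graph_def)
  have lt: "Suc i mod length C < length C"
    using assms(2) by (intro mod_less_divisor) auto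
  have "i \<noteq> Suc i mod length C"
    using i(1) assms(2) by (cases "Suc i = length C") auto
  then have "C ! i \<noteq> C ! (Suc i mod length C)"
    using i(1) lt assms(1) by (simp add: nth_eq_iff_index_eq)
  with i lt show ?thesis
    by (intro exI[of _ "C ! i"] exI[of _ "C ! (Suc i mod length C)"]) simp
qed

lemma simple_graph_union_cycles:
  assumes "distinct C1" "3 \<le> length C1" "distinct C2" "3 \<le> length C2"
  shows "simple_graph (graph_union (cycle_graph C1) (cycle_graph C2))"
  unfolding simple_graph_def
proof (intro conjI ballI)
  show "finite (fst (graph_union (cycle_graph C1) (cycle_graph C2)))"
    by (simp add: graph_union_def cycle_graph_def)
  have [simp]: "fst (graph_union (cycle_graph C1) (cycle_graph C2)) = set C1 \<union> set C2"
    by (simp add: graph_union_def cycle_graph_def)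
  fix e assume "e \<in> snd (graph_union (cycle_graph C1) (cycle_graph C2))"
  then have "e \<in> snd (cycle_graph C1) \<or> e \<in> snd (cycle_graph C2)"
    by (simp add: graph_union_def)
  then show "\<exists>u v. e = {u, v} \<and> u \<noteq> v \<and>
      u \<in> fst (graph_union (cycle_graph C1) (cycle_graph C2)) \<and>
      v \<in> fst (graph_union (cycle_graph C1) (cycle_graph C2))"
    using cycle_graph_edge[OF assms(1,2)] cycle_graph_edge[OF assms(3,4)] by auto metis+
qed

lemma sum_Suc_mod: "(\<Sum>i<N. b (Suc i mod N)) = (\<Sum>i<N. b i)" for b :: "nat \<Rightarrow> 'a::comm_monoid_add"
proof (cases N)
  case (Suc k)
  have "(\<Sum>i<Suc k. b (Suc i mod Suc k)) = (\<Sum>i<k. b (Suc i)) + b 0"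
    by simp
  also have "\<dots> = (\<Sum>i<Suc k. b i)"
    by (simp only: sum.lessThan_Suc_shift add.commute)
  finally show ?thesis
    by (simp add: Suc)
qed simp

text \<open>Count cover vertices along the 2n+1 edges: every edge contributes at least 1 and every
  vertex is counted twice. So twice the number is at least 2n+1, and parity raises the bound to
  n+1.\<close>

lemma vdeg_odd_cycle_ge:
  assumes "length C = 2 * n + 1" "finite V"
    and "\<And>i. i < length C \<Longrightarrow> C ! i \<in> V \<or> C ! (Suc i mod length C) \<in> V"
  shows "n + 1 \<le> vdeg V (\<Sum>i<length C. Poly_Mapping.single (C ! i) 1)"
proof -
  define b :: "nat \<Rightarrow> nat" where "b i = (if C ! i \<in> V then 1 else 0)" for i
  have "2 * n + 1 = (\<Sum>i<length C. 1)"
    using assms(1) by simp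
  also have "\<dots> \<le> (\<Sum>i<length C. b i + b (Suc i mod length C))"
    using assms(3) by (intro sum_mono) (fastforce simp: b_def)
  also have "\<dots> = 2 * (\<Sum>i<length C. b i)"
    by (simp add: sum.distrib sum_Suc_mod)
  finally have "n + 1 \<le> (\<Sum>i<length C. b i)"
    by linarith
  then show ?thesis
    using assms(2) by (simp add: vdeg_sum vdeg_single b_def del: One_nat_def)
qed

theorem theorem3p12:
  fixes C1 C2 :: "'v list" and n m :: nat and G :: "'v graph"
  fixes R :: "(('v \<Rightarrow>\<^sub>0 nat) \<Rightarrow>\<^sub>0 'k::field) ring"
    and I :: "(('v \<Rightarrow>\<^sub>0 nat) \<Rightarrow>\<^sub>0 'k) set"
  assumes "1 \<le> n" and "n \<le> m"
    and "distinct C1" and "length C1 = 2 * n + 1"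
    and "distinct C2" and "length C2 = 2 * m + 1"
    and "hd C2 = hd C1" and "set C1 \<inter> set C2 = {hd C1}"
    and "G = graph_union (cycle_graph C1) (cycle_graph C2)"
    and "R = poly_ring (fst G)"
    and "I = edge_ideal G"
  shows "(\<forall>t::nat. int (alpha (symbolic_power R I t)) =
             2 * int t - \<lfloor>real t / real (n + 1)\<rfloor>) \<and>
         convergent (\<lambda>s. real (alpha (symbolic_power R I s)) / real s) \<and>
         waldschmidt_constant R I = real (2 * n + 1) / real (n + 1)"
proof -
  have G: "simple_graph G"
    unfolding assms(9) using assms by (intro simple_graph_union_cycles) auto
  then have fin: "finite (fst G)"
    by (simp add: simple_graph_def)
  have symb: "symbolic_power R I t = {f \<in> carrier (poly_ring (fst G)).
      \<forall>V. min_cover G V \<longrightarrow> (\<forall>m\<in>Poly_Mapping.keys f. t \<le> vdeg V m)}" for t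
    unfolding assms(10,11) by (rule symbolic_power_edge_ideal[OF G])
  obtain \<phi> :: "'v \<Rightarrow> nat" where hom: "\<And>u v. {u, v} \<in> snd G \<Longrightarrow>
      \<phi> v = Suc (\<phi> u) mod (2 * n + 1) \<or> \<phi> u = Suc (\<phi> v) mod (2 * n + 1)"
    using double_odd_cycle_hom[OF assms(1-8)] unfolding assms(9) by metis
  have alpha: "alpha (symbolic_power R I t) = 2 * t - t div (n + 1)" for t
  proof -
    define q r where "q = t div (n + 1)" and "r = t mod (n + 1)"
    have t: "t = q * (n + 1) + r"
      unfolding q_def r_def by (rule div_mult_mod_eq[symmetric])
    define cyc :: "'v \<Rightarrow>\<^sub>0 nat" where "cyc = (\<Sum>i<length C1. Poly_Mapping.single (C1 ! i) 1)"
    \<comment> \<open>Covering n+1 units by edges costs degree 2(n+1), but a full cycle costs 2n+1.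
      Each of the \<open>q\<close> cycles thus saves one degree; the remaining \<open>r\<close>
      units are paid by copies of one edge.\<close>
    define \<mu> :: "'v \<Rightarrow>\<^sub>0 nat" where
      "\<mu> = (\<Sum>j<q. cyc) + (Poly_Mapping.single (C1 ! 0) r + Poly_Mapping.single (C1 ! 1) r)"
    have C1: "C1 ! i \<in> fst G" if "i < length C1" for i
      using that by (simp add: assms(9) graph_union_def cycle_graph_def)
    have keys: "Poly_Mapping.keys \<mu> \<subseteq> fst G"
      using C1 assms(1,4) unfolding \<mu>_def cyc_def
      by (intro order_trans[OF keys_add] Un_least order_trans[OF keys_sum] UN_least) auto
    have "vdeg (fst G) cyc = (\<Sum>i<length C1. 1)"
      unfolding cyc_def vdeg_sum using C1 fin by (intro sum.cong) (auto simp: vdeg_single)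
    then have "monom_degree \<mu> = q * (2 * n + 1) + 2 * r"
      unfolding monom_degree_eq_vdeg[OF fin keys] unfolding \<mu>_def
      using C1[of 0] C1[of 1] assms(1,4) fin by (simp add: vdeg_add vdeg_sum vdeg_single)
    also have "\<dots> = 2 * t - q"
      unfolding t by (simp add: algebra_simps)
    finally have deg: "monom_degree \<mu> = 2 * t - q" .
    have "alpha (symbolic_power R I t) = monom_degree \<mu>"
    proof (rule alpha_eqI)
      have "t \<le> vdeg V \<mu>" if V: "min_cover G V" for V
      proof -
        have finV: "finite V"
          using V fin by (auto simp: min_cover_def vertex_cover_def intro: finite_subset)
        have cover: "C1 ! i \<in> V \<or> C1 ! (Suc i mod length C1) \<in> V" if "i < length C1" for i
        proof -
          have "{C1 ! i, C1 ! (Suc i mod length C1)} \<in> snd G"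
            using that by (auto simp: assms(9) graph_union_def cycle_graph_def)
          then show ?thesis
            using V by (auto simp: min_cover_def vertex_cover_def)
        qed
        have "q * (n + 1) \<le> q * vdeg V cyc"
          unfolding cyc_def using assms(4) finV cover
          by (intro mult_left_mono vdeg_odd_cycle_ge) auto
        moreover have "r \<le> vdeg V (Poly_Mapping.single (C1 ! 0) r + Poly_Mapping.single (C1 ! 1) r)"
          using cover[of 0] assms(1,4) finV by (auto simp: vdeg_add vdeg_single)
        ultimately show ?thesis
          unfolding t \<mu>_def by (simp add: vdeg_add vdeg_sum)
      qed
      with keys show "Poly_Mapping.single \<mu> 1 \<in> symbolic_power R I t"
        by (auto simp: symb single_in_poly_ring)
    next
      fix f m assume f: "f \<in> symbolic_power R I t" "m \<in> Poly_Mapping.keys f"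
      then have "(2 * n + 1) * t \<le> (n + 1) * monom_degree m"
        by (intro monom_degree_ge_of_hom_odd_cycle[OF G hom])
          (auto simp: symb carrier_poly_ring_iff)
      \<comment> \<open>The averaged bound falls short of \<open>2 * t - q\<close> by
        \<open>r / (n + 1)\<close>, which is less than 1, so an integer degree satisfying it is at
        least \<open>2 * t - q\<close>.\<close>
      moreover have "(2 * n + 1) * t + r = (n + 1) * (2 * t - q)"
        unfolding t by (simp add: algebra_simps)
      moreover have "r < n + 1"
        by (simp add: r_def)
      ultimately have "(n + 1) * (2 * t - q) < (n + 1) * (monom_degree m + 1)"
        by (simp add: algebra_simps)
      then show "monom_degree \<mu> \<le> monom_degree m"
        unfolding deg mult_less_cancel1 by linarith
    qed
    then show ?thesis
      by (simp add: deg q_def)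
  qed
  \<comment> \<open>Guarantees that the natural-number subtraction does not truncate when it is
    transferred to the integers.\<close>
  have div_le: "t div (n + 1) \<le> 2 * t" for t
    using div_le_dividend[of t "n + 1"] by linarith
  have formula: "int (alpha (symbolic_power R I t)) = 2 * int t - \<lfloor>real t / real (n + 1)\<rfloor>" for t
    using div_le[of t] unfolding alpha floor_divide_of_nat_eq by (simp only: of_nat_diff of_nat_mult of_nat_numeral)
  have "(\<lambda>s. real (alpha (symbolic_power R I s)) / real s) \<longlonglongrightarrow> real (2 * n + 1) / real (n + 1)"
  \<comment> \<open>The floor differs from its argument by less than 1, so the quotient lies within
    \<open>1 / s\<close> above the limit and never below it for positive \<open>s\<close>.\<close>
  proof (rule tendsto_sandwich)
    have eq: "real (alpha (symbolic_power R I s)) = 2 * real s - real_of_int \<lfloor>real s / real (n + 1)\<rfloor>" for s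
      using arg_cong[OF formula[of s], of real_of_int] by simp
    have c: "real (2 * n + 1) / real (n + 1) = 2 - 1 / real (n + 1)"
      by (simp add: field_simps)
    show "\<forall>\<^sub>F s in sequentially. real (2 * n + 1) / real (n + 1) \<le> real (alpha (symbolic_power R I s)) / real s"
      using eventually_gt_at_top[of 0]
    proof eventually_elim
      case (elim s)
      have "real_of_int \<lfloor>real s / real (n + 1)\<rfloor> \<le> 1 / real (n + 1) * real s"
        using of_int_floor_le[of "real s / real (n + 1)"] by simp
      then have "(2 - 1 / real (n + 1)) * real s \<le> 2 * real s - real_of_int \<lfloor>real s / real (n + 1)\<rfloor>"
        unfolding left_diff_distrib by linarith
      with elim show ?case
        unfolding eq c by (simp only: pos_le_divide_eq of_nat_0_less_iff)
    qed
    show "\<forall>\<^sub>F s in sequentially. real (alpha (symbolic_power R I s)) / real s \<le>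
        real (2 * n + 1) / real (n + 1) + 1 / real s"
      using eventually_gt_at_top[of 0]
    proof eventually_elim
      case (elim s)
      have "1 / real (n + 1) * real s - 1 \<le> real_of_int \<lfloor>real s / real (n + 1)\<rfloor>"
        using real_of_int_floor_gt_diff_one[of "real s / real (n + 1)"] by simp
      moreover have "(2 - 1 / real (n + 1) + 1 / real s) * real s = 2 * real s - 1 / real (n + 1) * real s + 1"
        using elim by (simp add: distrib_right left_diff_distrib)
      ultimately have "2 * real s - real_of_int \<lfloor>real s / real (n + 1)\<rfloor> \<le>
          (2 - 1 / real (n + 1) + 1 / real s) * real s"
        by linarith
      with elim show ?case
        unfolding eq c by (simp only: pos_divide_le_eq of_nat_0_less_iff)
    qed
    show "(\<lambda>s. real (2 * n + 1) / real (n + 1) + 1 / real s) \<longlonglongrightarrow> real (2 * n + 1) / real (n + 1)"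
      by (rule tendsto_eq_intros lim_const_over_n | simp)+
  qed simp
  then show ?thesis
    using formula unfolding waldschmidt_constant_def convergent_def by (auto intro: limI)
qed

end
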